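(* Let $M\in\mathbb R^{m\times n}$, let $\mathcal I\subseteq\{1,\dots,m\}$ and $\mathcal J\subseteq\{1,\dots,n\}$ be index sets of cardinality $k$ and $l$, respectively, and let $G:=M_{\mathcal I,\mathcal J}\in\mathbb R^{k\times l}$. Let $r$ be a positive integer with $r\le\min\{k,l\}$, let $0<\epsilon\le\sigma_r(G)$, and let $M'\in\mathbb R^{m\times n}$ be a matrix of rank $r$ such that $$\sigma_{r+1}(M)\le\|M-M'\|\le\epsilon .$$ Write $C:=M_{:,\mathcal J}$, $R:=M_{\mathcal I,:}$, $U:=G_r^+$, $$v:=\|U\|\max\{\|C\|,\|R\|\},\qquad \zeta:=\begin{cases}\sqrt2 & \text{if } r=\min\{k,l\},\\ (1+\sqrt5)/2 & \text{if } r<\min\{k,l\},\end{cases}$$ and assume that $\theta:=\epsilon\|U\|<1$. Then $$\|M-CUR\|\le (v+1)\Big(\frac{2\zeta}{1-\theta}(v+1)+2\Big)\epsilon,\qquad\text{where } 2\zeta\le 1+\sqrt5 .$$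
   Context: All matrices are real. $\|\cdot\|$ is the spectral norm; $\sigma_j(A)$ is the $j$-th largest singular value of $A$ (taken to be $0$ if $j$ exceeds the dimensions). $M_{\mathcal I,:}$, $M_{:,\mathcal J}$, $M_{\mathcal I,\mathcal J}$ denote the submatrices of $M$ formed by the rows indexed by $\mathcal I$, the columns indexed by $\mathcal J$, and both, respectively. $A_r$ (the $r$-truncation of $A$) is obtained from an SVD of $A$ by setting to $0$ all singular values except the $r$ largest. $A^+$ is the Moore–Penrose pseudo inverse of $A$. *)

theory Defs
  imports
    "Jordan_Normal_Form.Char_Poly"
    "Jordan_Normal_Form.DL_Rank"
    "Jordan_Normal_Form.DL_Submatrix"
begin

text \<open>Rows and columns of a \<^typ>\<open>real mat\<close> are numbered from 0, so an index set of an
  \<open>m \<times> n\<close> matrix is a subset of \<open>{..<m}\<close> or \<open>{..<n}\<close>. The submatrix keeping all rows and the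
  columns in \<open>J\<close> is \<open>submatrix M UNIV J\<close>. Singular values, in contrast, are numbered from 1.\<close>

definition vec_norm :: "real vec \<Rightarrow> real" where
  "vec_norm x = sqrt (x \<bullet> x)"

text \<open>The operator norm induced by the Euclidean norms; the set is never empty and bounded above.\<close>

definition spectral_norm :: "real mat \<Rightarrow> real" where
  "spectral_norm A =
     (SUP x \<in> {x \<in> carrier_vec (dim_col A). vec_norm x \<le> 1}. vec_norm (A *\<^sub>v x))"

text \<open>The \<open>j\<close>-th largest singular value, \<open>j \<ge> 1\<close>: the square root of the \<open>j\<close>-th largest eigenvalue
  of \<open>A\<^sup>T A\<close>, counted with multiplicity. As \<open>A\<^sup>T A\<close> is symmetric, its characteristic polynomial splits
  over the reals, so the list below has \<open>dim_col A\<close> entries.\<close>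

definition singular_value :: "real mat \<Rightarrow> nat \<Rightarrow> real" where
  "singular_value A j =
     (if 1 \<le> j \<and> j \<le> min (dim_row A) (dim_col A)
      then sqrt (rev (sorted_list_of_multiset (proots (char_poly (transpose_mat A * A)))) ! (j - 1))
      else 0)"

definition rect_diag :: "nat \<Rightarrow> nat \<Rightarrow> (nat \<Rightarrow> real) \<Rightarrow> real mat" where
  "rect_diag m n s = mat m n (\<lambda>(i, j). if i = j then s i else 0)"

text \<open>\<open>A = P \<Sigma> Q\<^sup>T\<close> with \<open>P\<close>, \<open>Q\<close> square orthogonal and \<open>\<Sigma>\<close> carrying the values
  \<open>s 0 \<ge> s 1 \<ge> \<dots> \<ge> 0\<close> on its diagonal.\<close>

definition is_svd :: "real mat \<Rightarrow> real mat \<Rightarrow> (nat \<Rightarrow> real) \<Rightarrow> real mat \<Rightarrow> bool" where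
  "is_svd A P s Q \<longleftrightarrow>
     (let m = dim_row A; n = dim_col A in
      P \<in> carrier_mat m m \<and> transpose_mat P * P = 1\<^sub>m m \<and>
      Q \<in> carrier_mat n n \<and> transpose_mat Q * Q = 1\<^sub>m n \<and>
      (\<forall>i < min m n. 0 \<le> s i) \<and>
      (\<forall>i j. i \<le> j \<longrightarrow> j < min m n \<longrightarrow> s j \<le> s i) \<and>
      A = P * rect_diag m n s * transpose_mat Q)"

text \<open>This is a relation, not a function: if the \<open>r\<close>-th and the \<open>(r+1)\<close>-st singular value of \<open>A\<close>
  coincide and are nonzero, the truncation depends on the chosen SVD.\<close>

definition is_truncation :: "nat \<Rightarrow> real mat \<Rightarrow> real mat \<Rightarrow> bool" where
  "is_truncation r A B \<longleftrightarrow>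
     (\<exists>P s Q. is_svd A P s Q \<and>
        B = P * rect_diag (dim_row A) (dim_col A) (\<lambda>i. if i < r then s i else 0) * transpose_mat Q)"

text \<open>The four Penrose conditions, which have exactly one solution for every real matrix.\<close>

definition is_pseudo_inverse :: "real mat \<Rightarrow> real mat \<Rightarrow> bool" where
  "is_pseudo_inverse A X \<longleftrightarrow>
     X \<in> carrier_mat (dim_col A) (dim_row A) \<and>
     A * X * A = A \<and> X * A * X = X \<and>
     transpose_mat (A * X) = A * X \<and> transpose_mat (X * A) = X * A"

definition pseudo_inverse :: "real mat \<Rightarrow> real mat" where
  "pseudo_inverse A = (THE X. is_pseudo_inverse A X)"

end

theory Submission
  imports Defs "HOL-Analysis.L2_Norm"
begin

text \<open>Let \<open>S\<close> select the rows in \<open>I\<close> and \<open>T\<close> the columns in \<open>J\<close>, so that \<open>G = S M T\<close>, \<open>C = M T\<close> and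
  \<open>R = S M\<close>, and let \<open>C'\<close>, \<open>R'\<close> and \<open>G'\<close> be formed in the same way from the rank \<open>r\<close> matrix \<open>M'\<close>. Each
  differs from its counterpart by at most \<open>\<epsilon>\<close> in norm. The point is that the CUR approximation of
  \<open>M'\<close> is exact: a rank \<open>r\<close> matrix whose submatrix \<open>G'\<close> still has rank \<open>r\<close> satisfies
  \<open>M' = C' W R'\<close>, where \<open>W\<close> is the pseudo inverse of \<open>G'\<close>. So \<open>M - C U R\<close> is \<open>M - M'\<close> plus the error
  made by replacing the three factors of \<open>C' W R'\<close> one after the other. The changes of \<open>C'\<close> and
  \<open>R'\<close> cost \<open>v \<epsilon>\<close> and \<open>(v + 1) \<epsilon>\<close>.

  The change from \<open>W\<close> to \<open>U\<close> is a perturbation of pseudo inverses of matrices of the same rank \<open>r\<close>,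
  namely \<open>G'\<close> and the truncation \<open>A\<close> of \<open>G\<close>. Wedin's theorem (lemma \<open>Wedin\<close>) gives
  \<open>\<parallel>W - U\<parallel> \<le> \<zeta> \<parallel>A - G'\<parallel> \<parallel>U\<parallel> \<parallel>W\<parallel>\<close>; its heart is that the gap between the ranges of two
  orthogonal projections of equal rank is symmetric (\<open>projection_gap_le\<close>). Here
  \<open>\<parallel>A - G'\<parallel> \<le> \<parallel>A - G\<parallel> + \<parallel>G - G'\<parallel> \<le> 2 \<epsilon>\<close>, because no matrix of rank at most \<open>r\<close>, in particular not
  \<open>G'\<close>, is closer to \<open>G\<close> than \<open>A\<close> (\<open>truncation_error_le\<close>). Finally \<open>\<epsilon> \<parallel>U\<parallel> = \<theta> < 1\<close> forces \<open>G'\<close> to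
  have rank \<open>r\<close> with \<open>\<parallel>W\<parallel> \<le> \<parallel>U\<parallel> / (1 - \<theta>)\<close> (\<open>nearby_pseudo_inverse\<close>). The pieces are put together
  in \<open>cur_error_bound\<close>.

  The hypothesis \<open>0 < \<epsilon> \<le> \<sigma>\<^sub>r(G)\<close> enters by making the truncation have rank exactly \<open>r\<close>.\<close>

section \<open>Euclidean norm and spectral norm\<close>

lemma vec_norm_eq_L2_set: "vec_norm x = L2_set (\<lambda>i. x $ i) {0..<dim_vec x}"
  by (simp add: vec_norm_def L2_set_def scalar_prod_def power2_eq_square)

lemma vec_norm_nonneg [simp]: "0 \<le> vec_norm x"
  by (simp add: vec_norm_eq_L2_set)

lemma vec_norm_power2: "(vec_norm x)\<^sup>2 = x \<bullet> x"
proof -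
  have "0 \<le> x \<bullet> x" by (simp add: scalar_prod_def sum_nonneg)
  then show ?thesis by (simp add: vec_norm_def)
qed

lemma vec_norm_zero [simp]: "vec_norm (0\<^sub>v n) = 0"
  by (simp add: vec_norm_def)

lemma vec_norm_eq_0: "x \<in> carrier_vec n \<Longrightarrow> vec_norm x = 0 \<Longrightarrow> x = 0\<^sub>v n"
  by (intro eq_vecI) (auto simp: vec_norm_eq_L2_set L2_set_eq_0_iff)

lemma vec_norm_smult: "vec_norm (c \<cdot>\<^sub>v x) = \<bar>c\<bar> * vec_norm x"
proof -
  have "(c \<cdot>\<^sub>v x) \<bullet> (c \<cdot>\<^sub>v x) = c\<^sup>2 * (x \<bullet> x)"
    by (simp add: power2_eq_square mult.assoc)
  then show ?thesis by (simp add: vec_norm_def real_sqrt_mult)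
qed

lemma vec_norm_uminus: "vec_norm (- x) = vec_norm x"
  by (simp add: vec_norm_eq_L2_set L2_set_def)

lemma vec_norm_triangle:
  assumes "dim_vec x = dim_vec y"
  shows "vec_norm (x + y) \<le> vec_norm x + vec_norm y"
proof -
  have "vec_norm (x + y) = L2_set (\<lambda>i. x $ i + y $ i) {0..<dim_vec y}"
    unfolding vec_norm_eq_L2_set by (rule L2_set_cong) auto
  then show ?thesis
    using L2_set_triangle_ineq[of "\<lambda>i. x $ i" "\<lambda>i. y $ i"] assms by (simp add: vec_norm_eq_L2_set)
qed

lemma Cauchy_Schwarz_vec:
  assumes "dim_vec x = dim_vec y"
  shows "x \<bullet> y \<le> vec_norm x * vec_norm y"
proof -
  have "x \<bullet> y \<le> (\<Sum>i\<in>{0..<dim_vec y}. \<bar>x $ i\<bar> * \<bar>y $ i\<bar>)"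
    unfolding scalar_prod_def by (intro sum_mono) (simp flip: abs_mult)
  also have "\<dots> \<le> L2_set (\<lambda>i. x $ i) {0..<dim_vec y} * L2_set (\<lambda>i. y $ i) {0..<dim_vec y}"
    by (rule L2_set_mult_ineq)
  finally show ?thesis using assms by (simp add: vec_norm_eq_L2_set)
qed

lemma Pythagoras_vec:
  assumes x: "x \<in> carrier_vec n" and y: "y \<in> carrier_vec n" and orth: "x \<bullet> y = 0"
  shows "(vec_norm (x + y))\<^sup>2 = (vec_norm x)\<^sup>2 + (vec_norm y)\<^sup>2"
proof -
  have "y \<bullet> x = 0" using comm_scalar_prod[OF x y] orth by simp
  moreover have "(x + y) \<bullet> (x + y) = (x \<bullet> x + x \<bullet> y) + (y \<bullet> x + y \<bullet> y)"
    using x y by (simp add: add_scalar_prod_distrib[of _ n] scalar_prod_add_distrib[of _ n])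
  ultimately show ?thesis using orth by (simp add: vec_norm_power2)
qed

text \<open>Matrix algebra with side conditions on dimensions only. The simplifier discharges such
  conditions for arbitrarily nested products, whereas the carrier of an intermediate dimension
  cannot be guessed.\<close>

lemma mult_assoc_dim:
  fixes A B C :: "real mat"
  assumes "dim_col A = dim_row B" "dim_col B = dim_row C"
  shows "A * B * C = A * (B * C)"
  using assms by (intro assoc_mult_mat[of _ "dim_row A" "dim_col A" _ "dim_col B" _ "dim_col C"]) auto

lemma mult_assoc_vec_dim:
  fixes A B :: "real mat"
  assumes "dim_col A = dim_row B" "dim_col B = dim_vec v"
  shows "A * B *\<^sub>v v = A *\<^sub>v (B *\<^sub>v v)"
  using assms by (intro assoc_mult_mat_vec[of _ "dim_row A" "dim_col A" _ "dim_col B"])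
    (auto intro: carrier_vecI)

lemma diff_mult_dim:
  fixes A B C :: "real mat"
  assumes "dim_row A = dim_row B" "dim_col A = dim_col B" "dim_col B = dim_row C"
  shows "(A - B) * C = A * C - B * C"
  using assms by (intro minus_mult_distrib_mat[of _ "dim_row A" "dim_col A" _ _ "dim_col C"]) auto

lemma mult_diff_dim:
  fixes A B C :: "real mat"
  assumes "dim_row B = dim_row C" "dim_col B = dim_col C" "dim_col A = dim_row C"
  shows "A * (B - C) = A * B - A * C"
  using assms by (intro mult_minus_distrib_mat[of _ "dim_row A" "dim_col A" _ "dim_col C"]) auto

lemma diff_mult_vec_dim:
  fixes A B :: "real mat"
  assumes "dim_row A = dim_row B" "dim_col A = dim_col B" "dim_col B = dim_vec v"
  shows "(A - B) *\<^sub>v v = A *\<^sub>v v - B *\<^sub>v v"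
  using assms by (intro minus_mult_distrib_mat_vec[of _ "dim_row A" "dim_col A"])
    (auto intro: carrier_vecI)

lemma mult_diff_vec_dim:
  fixes A :: "real mat"
  assumes "dim_vec v = dim_vec w" "dim_col A = dim_vec w"
  shows "A *\<^sub>v (v - w) = A *\<^sub>v v - A *\<^sub>v w"
  using assms by (intro mult_minus_distrib_mat_vec[of _ "dim_row A" "dim_col A"])
    (auto intro: carrier_vecI)

lemma transpose_mult_dim:
  fixes A B :: "real mat"
  assumes "dim_col A = dim_row B"
  shows "transpose_mat (A * B) = transpose_mat B * transpose_mat A"
  using assms by (intro transpose_mult[of _ "dim_row A" "dim_col A" _ "dim_col B"]) auto

lemma transpose_diff_dim:
  fixes A B :: "real mat"
  assumes "dim_row A = dim_row B" "dim_col A = dim_col B"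
  shows "transpose_mat (A - B) = transpose_mat A - transpose_mat B"
  using assms by (intro transpose_minus[of _ "dim_row A" "dim_col A"]) auto

lemma transpose_scalar_prod:
  fixes A :: "real mat"
  assumes "dim_vec x = dim_col A" "dim_vec y = dim_row A"
  shows "(A *\<^sub>v x) \<bullet> y = x \<bullet> (transpose_mat A *\<^sub>v y)"
proof -
  have "(transpose_mat (transpose_mat A) *\<^sub>v x) \<bullet> y = x \<bullet> (transpose_mat A *\<^sub>v y)"
    by (rule transpose_vec_mult_scalar[of _ "dim_col A" "dim_row A"])
      (use assms in \<open>auto intro: carrier_vecI\<close>)
  then show ?thesis by simp
qed

lemma mult_vec_zero:
  fixes A :: "real mat"
  assumes "dim_col A = n"
  shows "A *\<^sub>v 0\<^sub>v n = 0\<^sub>v (dim_row A)"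
  using assms by (intro eq_vecI) (auto intro: scalar_prod_right_zero carrier_vecI)

lemma mat_eq_by_mult_vec:
  fixes A B :: "real mat"
  assumes "A \<in> carrier_mat m n" "B \<in> carrier_mat m n"
    and "\<And>x. x \<in> carrier_vec n \<Longrightarrow> A *\<^sub>v x = B *\<^sub>v x"
  shows "A = B"
proof (rule eq_matI)
  fix i j assume ij: "i < dim_row B" "j < dim_col B"
  have "A *\<^sub>v unit_vec n j = B *\<^sub>v unit_vec n j" using assms by simp
  then have "(A *\<^sub>v unit_vec n j) $ i = (B *\<^sub>v unit_vec n j) $ i" by simp
  then show "A $$ (i, j) = B $$ (i, j)" using assms(1,2) ij by simp
qed (use assms in auto)

lemma bounded_mult_vec:
  assumes "x \<in> carrier_vec (dim_col A)"
  shows "vec_norm (A *\<^sub>v x) \<le> (\<Sum>i<dim_row A. vec_norm (row A i)) * vec_norm x"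
proof -
  have "vec_norm (A *\<^sub>v x) \<le> (\<Sum>i\<in>{0..<dim_row A}. \<bar>(A *\<^sub>v x) $ i\<bar>)"
    unfolding vec_norm_eq_L2_set dim_mult_mat_vec by (rule L2_set_le_sum_abs)
  also have "\<dots> \<le> (\<Sum>i\<in>{0..<dim_row A}. vec_norm (row A i) * vec_norm x)"
  proof (rule sum_mono)
    fix i assume i: "i \<in> {0..<dim_row A}"
    have "row A i \<bullet> x \<le> vec_norm (row A i) * vec_norm x"
      using assms by (intro Cauchy_Schwarz_vec) simp
    moreover have "(- row A i) \<bullet> x \<le> vec_norm (row A i) * vec_norm x"
      using assms Cauchy_Schwarz_vec[of "- row A i" x] by (simp add: vec_norm_uminus)
    ultimately show "\<bar>(A *\<^sub>v x) $ i\<bar> \<le> vec_norm (row A i) * vec_norm x"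
      using assms i by simp
  qed
  also have "\<dots> = (\<Sum>i<dim_row A. vec_norm (row A i)) * vec_norm x"
    by (simp add: sum_distrib_right atLeast0LessThan)
  finally show ?thesis .
qed

lemma spectral_norm_bdd:
  "bdd_above ((\<lambda>x. vec_norm (A *\<^sub>v x)) ` {x \<in> carrier_vec (dim_col A). vec_norm x \<le> 1})"
proof (intro bdd_aboveI[of _ "\<Sum>i<dim_row A. vec_norm (row A i)"], clarify)
  fix x :: "real vec" assume x: "x \<in> carrier_vec (dim_col A)" "vec_norm x \<le> 1"
  have "0 \<le> (\<Sum>i<dim_row A. vec_norm (row A i))" by (intro sum_nonneg) simp
  then show "vec_norm (A *\<^sub>v x) \<le> (\<Sum>i<dim_row A. vec_norm (row A i))"
    using bounded_mult_vec[OF x(1)] x(2) by (meson mult_left_le order_trans)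
qed

lemma spectral_norm_nonneg [simp]: "0 \<le> spectral_norm A"
proof -
  have "vec_norm (A *\<^sub>v 0\<^sub>v (dim_col A)) \<le> spectral_norm A"
    unfolding spectral_norm_def by (rule cSUP_upper[OF _ spectral_norm_bdd]) auto
  then show ?thesis using vec_norm_nonneg order_trans by blast
qed

lemma spectral_norm_bound:
  assumes "x \<in> carrier_vec (dim_col A)"
  shows "vec_norm (A *\<^sub>v x) \<le> spectral_norm A * vec_norm x"
proof (cases "vec_norm x = 0")
  case True
  then have "x = 0\<^sub>v (dim_col A)" using assms vec_norm_eq_0 by blast
  moreover have "A *\<^sub>v 0\<^sub>v (dim_col A) = 0\<^sub>v (dim_row A)" by (intro eq_vecI) auto
  ultimately show ?thesis using True by simp
next
  case False
  then have pos: "0 < vec_norm x" using vec_norm_nonneg[of x] by linarith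
  let ?y = "(1 / vec_norm x) \<cdot>\<^sub>v x"
  have "vec_norm (A *\<^sub>v ?y) \<le> spectral_norm A"
    unfolding spectral_norm_def
    by (rule cSUP_upper[OF _ spectral_norm_bdd]) (use assms pos in \<open>auto simp: vec_norm_smult\<close>)
  moreover have "A *\<^sub>v ?y = (1 / vec_norm x) \<cdot>\<^sub>v (A *\<^sub>v x)"
    using assms by (intro mult_mat_vec) auto
  ultimately show ?thesis using pos by (simp add: vec_norm_smult field_simps)
qed

lemma spectral_norm_least:
  assumes "0 \<le> c"
    and "\<And>x. x \<in> carrier_vec (dim_col A) \<Longrightarrow> vec_norm (A *\<^sub>v x) \<le> c * vec_norm x"
  shows "spectral_norm A \<le> c"
  unfolding spectral_norm_def
proof (rule cSUP_least)
  have "0\<^sub>v (dim_col A) \<in> {x \<in> carrier_vec (dim_col A). vec_norm x \<le> 1}" by simp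
  then show "{x \<in> carrier_vec (dim_col A). vec_norm x \<le> 1} \<noteq> {}" by blast
next
  fix x :: "real vec" assume "x \<in> {x \<in> carrier_vec (dim_col A). vec_norm x \<le> 1}"
  then show "vec_norm (A *\<^sub>v x) \<le> c"
    using assms by (smt (verit) mem_Collect_eq mult_left_le)
qed

lemma spectral_norm_mult:
  assumes "dim_col A = dim_row B"
  shows "spectral_norm (A * B) \<le> spectral_norm A * spectral_norm B"
proof (rule spectral_norm_least)
  fix x :: "real vec" assume "x \<in> carrier_vec (dim_col (A * B))"
  then have x: "x \<in> carrier_vec (dim_col B)" by simp
  have "vec_norm (A * B *\<^sub>v x) = vec_norm (A *\<^sub>v (B *\<^sub>v x))"
    using assms x by (simp add: mult_assoc_vec_dim)
  also have "\<dots> \<le> spectral_norm A * vec_norm (B *\<^sub>v x)"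
    using assms by (intro spectral_norm_bound) (auto intro: carrier_vecI)
  also have "\<dots> \<le> spectral_norm A * (spectral_norm B * vec_norm x)"
    using x by (intro mult_left_mono spectral_norm_bound) auto
  finally show "vec_norm (A * B *\<^sub>v x) \<le> spectral_norm A * spectral_norm B * vec_norm x"
    by (simp add: mult.assoc)
qed simp

lemma spectral_norm_mult_le:
  assumes "dim_col A = dim_row B" "spectral_norm A \<le> a" "spectral_norm B \<le> b"
  shows "spectral_norm (A * B) \<le> a * b"
  using spectral_norm_mult[OF assms(1)] assms(2,3)
  by (meson mult_mono order_trans spectral_norm_nonneg)

lemma spectral_norm_add:
  assumes "dim_row A = dim_row B" "dim_col A = dim_col B"
  shows "spectral_norm (A + B) \<le> spectral_norm A + spectral_norm B"
proof (rule spectral_norm_least)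
  fix x :: "real vec" assume "x \<in> carrier_vec (dim_col (A + B))"
  then have x: "x \<in> carrier_vec (dim_col A)" "x \<in> carrier_vec (dim_col B)" using assms by auto
  have "(A + B) *\<^sub>v x = A *\<^sub>v x + B *\<^sub>v x"
    using assms x by (intro add_mult_distrib_mat_vec[of _ "dim_row A" "dim_col A"]) auto
  then have "vec_norm ((A + B) *\<^sub>v x) \<le> vec_norm (A *\<^sub>v x) + vec_norm (B *\<^sub>v x)"
    using assms by (simp add: vec_norm_triangle)
  also have "\<dots> \<le> spectral_norm A * vec_norm x + spectral_norm B * vec_norm x"
    using x by (intro add_mono spectral_norm_bound)
  finally show "vec_norm ((A + B) *\<^sub>v x) \<le> (spectral_norm A + spectral_norm B) * vec_norm x"
    by (simp add: distrib_right)
qed simp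

lemma spectral_norm_minus_commute:
  assumes "dim_row A = dim_row B" "dim_col A = dim_col B"
  shows "spectral_norm (A - B) = spectral_norm (B - A)"
proof -
  have "vec_norm ((A - B) *\<^sub>v x) = vec_norm ((B - A) *\<^sub>v x)" if "x \<in> carrier_vec (dim_col A)" for x
  proof -
    have "(A - B) *\<^sub>v x = - ((B - A) *\<^sub>v x)"
      using assms that by (intro eq_vecI) (auto simp: diff_mult_vec_dim)
    then show ?thesis by (simp add: vec_norm_uminus)
  qed
  then show ?thesis using assms unfolding spectral_norm_def by (intro SUP_cong) auto
qed

lemma spectral_norm_transpose_le: "spectral_norm (transpose_mat A) \<le> spectral_norm A"
proof (rule spectral_norm_least)
  fix y :: "real vec" assume "y \<in> carrier_vec (dim_col (transpose_mat A))"
  then have y: "dim_vec y = dim_row A" by simp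
  let ?z = "transpose_mat A *\<^sub>v y"
  have z: "?z \<in> carrier_vec (dim_col A)" by (auto intro: carrier_vecI)
  have "vec_norm ?z * vec_norm ?z = (A *\<^sub>v ?z) \<bullet> y"
    using transpose_scalar_prod[of ?z A y] y by (simp flip: power2_eq_square add: vec_norm_power2)
  also have "\<dots> \<le> vec_norm (A *\<^sub>v ?z) * vec_norm y" using y by (intro Cauchy_Schwarz_vec) simp
  also have "\<dots> \<le> (spectral_norm A * vec_norm ?z) * vec_norm y"
    using z by (intro mult_right_mono spectral_norm_bound) auto
  finally have "vec_norm ?z * vec_norm ?z \<le> vec_norm ?z * (spectral_norm A * vec_norm y)"
    by (simp add: mult_ac)
  then show "vec_norm ?z \<le> spectral_norm A * vec_norm y"
    by (smt (verit) mult_le_cancel_left_pos mult_nonneg_nonneg spectral_norm_nonneg vec_norm_nonneg)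
qed simp

lemma spectral_norm_transpose: "spectral_norm (transpose_mat A) = spectral_norm A"
  using spectral_norm_transpose_le[of A] spectral_norm_transpose_le[of "transpose_mat A"] by simp

lemma vec_norm_isometry:
  assumes "transpose_mat A * A = 1\<^sub>m n" "x \<in> carrier_vec n" "dim_col A = n"
  shows "vec_norm (A *\<^sub>v x) = vec_norm x"
proof -
  have "(A *\<^sub>v x) \<bullet> (A *\<^sub>v x) = x \<bullet> (transpose_mat A * A *\<^sub>v x)"
    using assms(2,3) by (simp add: transpose_scalar_prod mult_assoc_vec_dim)
  then show ?thesis using assms by (simp add: vec_norm_def)
qed

section \<open>Orthogonal projections of equal rank\<close>

lemma inverse_of_injective:
  fixes A :: "real mat"
  assumes A: "A \<in> carrier_mat r r"
    and inj: "\<And>v. v \<in> carrier_vec r \<Longrightarrow> A *\<^sub>v v = 0\<^sub>v r \<Longrightarrow> v = 0\<^sub>v r"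
  obtains B where "B \<in> carrier_mat r r" "A * B = 1\<^sub>m r" "B * A = 1\<^sub>m r"
proof -
  have "det A \<noteq> 0" unfolding det_0_iff_vec_prod_zero[OF A] using inj by blast
  from det_non_zero_imp_unit[OF A this, of "()"] show ?thesis
    using that by (auto simp: Units_def ring_mat_def)
qed

definition orth_projection :: "nat \<Rightarrow> real mat \<Rightarrow> bool" where
  "orth_projection n P \<longleftrightarrow> P \<in> carrier_mat n n \<and> P * P = P \<and> transpose_mat P = P"

text \<open>The rank is recorded by a factorization through \<open>\<real>\<^sup>r\<close>; the equation \<open>L X = 1\<close> says that both
  factors have full rank. In this form a dimension count becomes the invertibility of an
  \<open>r \<times> r\<close> matrix.\<close>

definition rank_projection :: "nat \<Rightarrow> nat \<Rightarrow> real mat \<Rightarrow> bool" where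
  "rank_projection n r P \<longleftrightarrow> orth_projection n P \<and>
     (\<exists>X L. X \<in> carrier_mat n r \<and> L \<in> carrier_mat r n \<and> P = X * L \<and> L * X = 1\<^sub>m r)"

context
  fixes n :: nat and P :: "real mat"
  assumes P: "orth_projection n P"
begin

lemma orth_projection_dims: "dim_row P = n" "dim_col P = n" "P \<in> carrier_mat n n"
  using P by (auto simp: orth_projection_def)

lemma orth_projection_idem: "x \<in> carrier_vec n \<Longrightarrow> P *\<^sub>v (P *\<^sub>v x) = P *\<^sub>v x"
  using P by (metis assoc_mult_mat_vec orth_projection_def)

lemma orth_projection_selfadjoint:
  assumes "x \<in> carrier_vec n" "y \<in> carrier_vec n"
  shows "(P *\<^sub>v x) \<bullet> y = x \<bullet> (P *\<^sub>v y)"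
  using P transpose_scalar_prod[of x P y] assms by (auto simp: orth_projection_def)

lemma orth_projection_Pythagoras:
  assumes x: "x \<in> carrier_vec n"
  shows "(vec_norm x)\<^sup>2 = (vec_norm (P *\<^sub>v x))\<^sup>2 + (vec_norm (x - P *\<^sub>v x))\<^sup>2"
proof -
  note [simp] = orth_projection_dims
  have Px: "P *\<^sub>v x \<in> carrier_vec n" by (auto intro: carrier_vecI)
  have "(P *\<^sub>v x) \<bullet> (x - P *\<^sub>v x) = (P *\<^sub>v x) \<bullet> x - (P *\<^sub>v x) \<bullet> (P *\<^sub>v x)"
    using x Px by (intro scalar_prod_minus_distrib)
  also have "(P *\<^sub>v x) \<bullet> (P *\<^sub>v x) = x \<bullet> (P *\<^sub>v x)"
    using x Px by (simp add: orth_projection_selfadjoint orth_projection_idem)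
  finally have "(P *\<^sub>v x) \<bullet> (x - P *\<^sub>v x) = 0"
    using x by (simp add: orth_projection_selfadjoint)
  moreover have "P *\<^sub>v x + (x - P *\<^sub>v x) = x" using x by (intro eq_vecI) auto
  ultimately show ?thesis
    using Pythagoras_vec[OF Px, of "x - P *\<^sub>v x"] x Px by simp
qed

lemma orth_projection_contracts:
  assumes x: "x \<in> carrier_vec n"
  shows "vec_norm (P *\<^sub>v x) \<le> vec_norm x" "vec_norm (x - P *\<^sub>v x) \<le> vec_norm x"
  using orth_projection_Pythagoras[OF x]
  by (metis power2_le_imp_le vec_norm_nonneg le_add_same_cancel1 le_add_same_cancel2 zero_le_power2)+

lemma orth_projection_complement:
  assumes x: "x \<in> carrier_vec n"
  shows "(1\<^sub>m n - P) *\<^sub>v x = x - P *\<^sub>v x"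
  using x orth_projection_dims by (simp add: diff_mult_vec_dim)

lemma spectral_norm_orth_projection:
  "spectral_norm P \<le> 1" "spectral_norm (1\<^sub>m n - P) \<le> 1"
  using orth_projection_dims orth_projection_contracts orth_projection_complement
  by (auto intro!: spectral_norm_least)

end

text \<open>For projections of equal rank the two gaps \<open>\<parallel>(1 - P) Q\<parallel>\<close> and \<open>\<parallel>(1 - Q) P\<parallel>\<close> agree. If the
  first one, \<open>\<delta>\<close>, is less than 1, then \<open>P\<close> is injective on the range of \<open>Q\<close>, hence, the ranks being
  equal, maps it onto the range of \<open>P\<close>. So every \<open>y\<close> in the range of \<open>P\<close> is \<open>P z\<close> with \<open>Q z = z\<close>.
  The angle between \<open>y\<close> and \<open>z\<close> has cosine at least \<open>sqrt (1 - \<delta>\<^sup>2)\<close>, and the projection \<open>Q y\<close> is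
  at least as close to \<open>y\<close> as the line through \<open>z\<close> is.\<close>

lemma projection_gap_le:
  assumes P: "rank_projection n r P" and Q: "rank_projection n r Q"
  shows "spectral_norm ((1\<^sub>m n - Q) * P) \<le> spectral_norm ((1\<^sub>m n - P) * Q)"
proof -
  define \<delta> where "\<delta> = spectral_norm ((1\<^sub>m n - P) * Q)"
  have P': "orth_projection n P" and Q': "orth_projection n Q"
    using P Q by (auto simp: rank_projection_def)
  note dims [simp] = orth_projection_dims[OF P'] orth_projection_dims[OF Q']
  obtain X L where XL: "X \<in> carrier_mat n r" "L \<in> carrier_mat r n" "P = X * L" "L * X = 1\<^sub>m r"
    using P by (auto simp: rank_projection_def)
  obtain Z N where ZN: "Z \<in> carrier_mat n r" "N \<in> carrier_mat r n" "Q = Z * N" "N * Z = 1\<^sub>m r"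
    using Q by (auto simp: rank_projection_def)
  have dims' [simp]: "dim_row X = n" "dim_col X = r" "dim_row L = r" "dim_col L = n"
    "dim_row Z = n" "dim_col Z = r" "dim_row N = r" "dim_col N = n"
    using XL ZN by auto
  have mem [simp]: "P *\<^sub>v x \<in> carrier_vec n" "Q *\<^sub>v x \<in> carrier_vec n" "Z *\<^sub>v x \<in> carrier_vec n"
    "X *\<^sub>v x \<in> carrier_vec n" "L *\<^sub>v x \<in> carrier_vec r" "N *\<^sub>v x \<in> carrier_vec r" for x
    by (auto intro: carrier_vecI)
  have QZ: "Q *\<^sub>v (Z *\<^sub>v w) = Z *\<^sub>v w" if "w \<in> carrier_vec r" for w
  proof -
    have "N *\<^sub>v (Z *\<^sub>v w) = w" using that ZN(4) by (simp flip: mult_assoc_vec_dim)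
    then show ?thesis using that ZN(3) by (simp add: mult_assoc_vec_dim)
  qed
  have gap: "vec_norm (z - P *\<^sub>v z) \<le> \<delta> * vec_norm z" if "z \<in> carrier_vec n" "Q *\<^sub>v z = z" for z
  proof -
    have "vec_norm ((1\<^sub>m n - P) * Q *\<^sub>v z) \<le> \<delta> * vec_norm z"
      unfolding \<delta>_def using that by (intro spectral_norm_bound) simp
    then show ?thesis using that P' by (simp add: mult_assoc_vec_dim orth_projection_complement)
  qed
  have "vec_norm ((1\<^sub>m n - Q) * P *\<^sub>v x) \<le> \<delta> * vec_norm x" if x: "x \<in> carrier_vec n" for x
  proof -
    define y where "y = P *\<^sub>v x"
    have y [simp]: "y \<in> carrier_vec n" "dim_vec y = n" by (simp_all add: y_def)
    have "vec_norm (y - Q *\<^sub>v y) \<le> \<delta> * vec_norm y"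
    proof (cases "\<delta> < 1")
      case False
      have "vec_norm (y - Q *\<^sub>v y) \<le> 1 * vec_norm y"
        using orth_projection_contracts(2)[OF Q' y(1)] by simp
      also have "\<dots> \<le> \<delta> * vec_norm y" using False by (intro mult_right_mono) auto
      finally show ?thesis .
    next
      case True
      have "L * Z \<in> carrier_mat r r" using XL ZN by simp
      then obtain H where H: "H \<in> carrier_mat r r" "L * Z * H = 1\<^sub>m r"
      proof (rule inverse_of_injective)
        fix w :: "real vec" assume w: "w \<in> carrier_vec r" and 0: "L * Z *\<^sub>v w = 0\<^sub>v r"
        have "P *\<^sub>v (Z *\<^sub>v w) = X *\<^sub>v (L * Z *\<^sub>v w)" using XL(3) w by (simp add: mult_assoc_vec_dim)
        also have "\<dots> = 0\<^sub>v n" unfolding 0 by (simp add: mult_vec_zero)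
        finally have "vec_norm (Z *\<^sub>v w) \<le> \<delta> * vec_norm (Z *\<^sub>v w)"
          using gap[of "Z *\<^sub>v w"] QZ[OF w] by simp
        then have "vec_norm (Z *\<^sub>v w) = 0"
          using True vec_norm_nonneg[of "Z *\<^sub>v w"]
          by (smt (verit) mult_less_cancel_right2 mult_le_cancel_right1)
        then have "Z *\<^sub>v w = 0\<^sub>v n" using vec_norm_eq_0[of "Z *\<^sub>v w" n] by simp
        then have "N *\<^sub>v (Z *\<^sub>v w) = 0\<^sub>v r" by (simp add: mult_vec_zero)
        then show "w = 0\<^sub>v r" using w ZN(4) by (simp flip: mult_assoc_vec_dim)
      qed blast
      have [simp]: "dim_row H = r" "dim_col H = r" using H by auto
      define z where "z = Z *\<^sub>v (H *\<^sub>v (L *\<^sub>v x))"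
      have z [simp]: "z \<in> carrier_vec n" "dim_vec z = n" by (simp_all add: z_def)
      have Qz: "Q *\<^sub>v z = z" unfolding z_def by (rule QZ) (auto intro: carrier_vecI)
      have "L *\<^sub>v z = L * Z * H *\<^sub>v (L *\<^sub>v x)" by (simp add: z_def mult_assoc_vec_dim)
      then have Lz: "L *\<^sub>v z = L *\<^sub>v x" unfolding H(2) by simp
      have Pz: "P *\<^sub>v z = y" using XL(3) Lz x z by (simp add: y_def mult_assoc_vec_dim)
      have "(Q *\<^sub>v y) \<bullet> z = (P *\<^sub>v z) \<bullet> (P *\<^sub>v z)"
        using orth_projection_selfadjoint[OF Q' y(1) z(1)] orth_projection_selfadjoint[OF P' z(1), of "P *\<^sub>v z"]
          comm_scalar_prod[OF y(1) z(1)] orth_projection_idem[OF P' z(1)] by (simp add: Qz Pz)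
      then have "(vec_norm y)\<^sup>2 \<le> vec_norm (Q *\<^sub>v y) * vec_norm z"
        using Cauchy_Schwarz_vec[of "Q *\<^sub>v y" z] z by (simp add: Pz vec_norm_power2)
      then have 1: "((vec_norm y)\<^sup>2)\<^sup>2 \<le> (vec_norm (Q *\<^sub>v y))\<^sup>2 * (vec_norm z)\<^sup>2"
        by (metis power_mono power_mult_distrib zero_le_power2)
      have "(vec_norm (z - P *\<^sub>v z))\<^sup>2 \<le> (\<delta> * vec_norm z)\<^sup>2"
        using gap[OF z(1) Qz] by (intro power_mono) auto
      then have 2: "(1 - \<delta>\<^sup>2) * (vec_norm z)\<^sup>2 \<le> (vec_norm y)\<^sup>2"
        using orth_projection_Pythagoras[OF P' z(1)] by (simp add: Pz power_mult_distrib algebra_simps)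
      have "0 \<le> \<delta>" by (simp add: \<delta>_def)
      then have \<delta>1: "0 \<le> 1 - \<delta>\<^sup>2" using True by (simp add: power_le_one)
      have "(1 - \<delta>\<^sup>2) * (vec_norm y)\<^sup>2 \<le> (vec_norm (Q *\<^sub>v y))\<^sup>2"
      proof (cases "vec_norm y = 0")
        case False
        have "(1 - \<delta>\<^sup>2) * ((vec_norm y)\<^sup>2)\<^sup>2 \<le> (1 - \<delta>\<^sup>2) * ((vec_norm (Q *\<^sub>v y))\<^sup>2 * (vec_norm z)\<^sup>2)"
          using 1 \<delta>1 by (rule mult_left_mono)
        also have "\<dots> = (vec_norm (Q *\<^sub>v y))\<^sup>2 * ((1 - \<delta>\<^sup>2) * (vec_norm z)\<^sup>2)" by simp
        also have "\<dots> \<le> (vec_norm (Q *\<^sub>v y))\<^sup>2 * (vec_norm y)\<^sup>2"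
          using 2 by (rule mult_left_mono) simp
        finally have "((1 - \<delta>\<^sup>2) * (vec_norm y)\<^sup>2) * (vec_norm y)\<^sup>2
            \<le> (vec_norm (Q *\<^sub>v y))\<^sup>2 * (vec_norm y)\<^sup>2" by (simp add: power2_eq_square mult_ac)
        moreover have "0 < (vec_norm y)\<^sup>2" using False by simp
        ultimately show ?thesis by (rule mult_right_le_imp_le)
      qed simp
      then have "(vec_norm (y - Q *\<^sub>v y))\<^sup>2 \<le> (\<delta> * vec_norm y)\<^sup>2"
        using orth_projection_Pythagoras[OF Q' y(1)] by (simp add: power_mult_distrib algebra_simps)
      then show ?thesis by (rule power2_le_imp_le) (simp add: \<open>0 \<le> \<delta>\<close>)
    qed
    also have "\<dots> \<le> \<delta> * vec_norm x"
      using orth_projection_contracts(1)[OF P' x] by (intro mult_left_mono) (auto simp: y_def \<delta>_def)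
    finally show ?thesis
      using x orth_projection_complement[OF Q' y(1)] by (simp add: mult_assoc_vec_dim y_def)
  qed
  then show ?thesis
    unfolding \<delta>_def[symmetric] by (intro spectral_norm_least) (auto simp: \<delta>_def)
qed

lemma rank_projection_full:
  assumes "rank_projection n n P"
  shows "P = 1\<^sub>m n"
  using assms mat_mult_left_right_inverse unfolding rank_projection_def by blast

section \<open>Pseudo inverses and full rank factorizations\<close>

lemma is_pseudo_inverse_unique:
  assumes X: "is_pseudo_inverse A X" and Z: "is_pseudo_inverse A Z"
  shows "X = Z"
proof -
  have [simp]: "dim_row X = dim_col A" "dim_col X = dim_row A"
    "dim_row Z = dim_col A" "dim_col Z = dim_row A"
    using X Z by (auto simp: is_pseudo_inverse_def)
  note X' = X[unfolded is_pseudo_inverse_def] and Z' = Z[unfolded is_pseudo_inverse_def]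
  \<comment> \<open>both \<open>A X\<close> and \<open>A Z\<close> are the orthogonal projection onto the range of \<open>A\<close>\<close>
  have "A * X = transpose_mat ((A * Z) * (A * X))"
    using X' Z' by (simp add: mult_assoc_dim[symmetric])
  also have "\<dots> = (A * X) * (A * Z)" using X' Z' by (simp add: transpose_mult_dim)
  also have "\<dots> = A * Z" using X' by (simp add: mult_assoc_dim[symmetric])
  finally have AX: "A * X = A * Z" .
  have "X * A = transpose_mat ((X * A) * (Z * A))"
    using X' Z' by (simp add: mult_assoc_dim)
  also have "\<dots> = (Z * A) * (X * A)" using X' Z' by (simp add: transpose_mult_dim)
  also have "\<dots> = Z * (A * X * A)" by (simp add: mult_assoc_dim)
  also have "\<dots> = Z * A" using X' by simp
  finally have XA: "X * A = Z * A" .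
  have "X = X * A * X" using X' by simp
  also have "\<dots> = Z * (A * X)" unfolding XA by (simp add: mult_assoc_dim)
  also have "\<dots> = Z * A * Z" unfolding AX by (simp add: mult_assoc_dim)
  also have "\<dots> = Z" using Z' by simp
  finally show ?thesis .
qed

lemma pseudo_inverse_eq: "is_pseudo_inverse A X \<Longrightarrow> pseudo_inverse A = X"
  unfolding pseudo_inverse_def by (rule the_equality) (auto dest: is_pseudo_inverse_unique)

text \<open>The last equation expresses that \<open>A\<close> has rank \<open>r\<close>: it makes both factors of full rank.\<close>

definition rank_pseudo_inverse :: "nat \<Rightarrow> real mat \<Rightarrow> real mat \<Rightarrow> bool" where
  "rank_pseudo_inverse r A U \<longleftrightarrow> is_pseudo_inverse A U \<and>
     (\<exists>X Y. X \<in> carrier_mat (dim_row A) r \<and> Y \<in> carrier_mat r (dim_col A) \<and>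
        A = X * Y \<and> Y * U * X = 1\<^sub>m r)"

lemma pseudo_inverse_projections:
  assumes "is_pseudo_inverse A U"
  shows "orth_projection (dim_row A) (A * U)" "orth_projection (dim_col A) (U * A)"
proof -
  have U: "U \<in> carrier_mat (dim_col A) (dim_row A)" and AUA: "A * U * A = A" "U * A * U = U"
    and "transpose_mat (A * U) = A * U" "transpose_mat (U * A) = U * A"
    using assms by (auto simp: is_pseudo_inverse_def)
  moreover have "A * U * (A * U) = A * U * A * U" "U * A * (U * A) = U * A * U * A"
    using U by (simp_all add: mult_assoc_dim)
  ultimately show "orth_projection (dim_row A) (A * U)" "orth_projection (dim_col A) (U * A)"
    by (auto simp: orth_projection_def)
qed

lemma rank_pseudo_inverse_projections:
  assumes "rank_pseudo_inverse r A U"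
  shows "rank_projection (dim_row A) r (A * U)" "rank_projection (dim_col A) r (U * A)"
proof -
  have U: "is_pseudo_inverse A U" using assms by (simp add: rank_pseudo_inverse_def)
  then have dimU [simp]: "dim_row U = dim_col A" "dim_col U = dim_row A"
    by (auto simp: is_pseudo_inverse_def)
  obtain X Y where XY: "X \<in> carrier_mat (dim_row A) r" "Y \<in> carrier_mat r (dim_col A)"
      "A = X * Y" "Y * U * X = 1\<^sub>m r"
    using assms unfolding rank_pseudo_inverse_def by blast
  have [simp]: "dim_row X = dim_row A" "dim_col X = r" "dim_row Y = r" "dim_col Y = dim_col A"
    using XY(1,2) by auto
  have "A * U = X * (Y * U)" using XY(3) by (metis mult_assoc_dim dimU(1) \<open>dim_col X = r\<close> \<open>dim_row Y = r\<close> \<open>dim_col Y = dim_col A\<close>)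
  moreover have "Y * U \<in> carrier_mat r (dim_row A)" by (intro carrier_matI) auto
  ultimately show "rank_projection (dim_row A) r (A * U)"
    using pseudo_inverse_projections(1)[OF U] XY unfolding rank_projection_def by blast
  have "U * A = (U * X) * Y" using XY(3) by (metis mult_assoc_dim dimU(2) \<open>dim_col X = r\<close> \<open>dim_row Y = r\<close> \<open>dim_row X = dim_row A\<close>)
  moreover have "U * X \<in> carrier_mat (dim_col A) r" by (intro carrier_matI) auto
  moreover have "Y * (U * X) = 1\<^sub>m r" using XY(4) by (simp add: mult_assoc_dim)
  ultimately show "rank_projection (dim_col A) r (U * A)"
    using pseudo_inverse_projections(2)[OF U] XY(2) unfolding rank_projection_def by blast
qed

lemma Gram_inverse:
  fixes X :: "real mat"
  assumes X: "X \<in> carrier_mat m r"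
    and inj: "\<And>v. v \<in> carrier_vec r \<Longrightarrow> X *\<^sub>v v = 0\<^sub>v m \<Longrightarrow> v = 0\<^sub>v r"
  obtains K where "K \<in> carrier_mat r r" "transpose_mat X * X * K = 1\<^sub>m r"
    "K * (transpose_mat X * X) = 1\<^sub>m r" "transpose_mat K = K"
proof -
  have [simp]: "dim_row X = m" "dim_col X = r" using X by auto
  have "transpose_mat X * X \<in> carrier_mat r r" using X by simp
  then obtain K where K: "K \<in> carrier_mat r r" "transpose_mat X * X * K = 1\<^sub>m r"
    "K * (transpose_mat X * X) = 1\<^sub>m r"
  proof (rule inverse_of_injective)
    fix v :: "real vec" assume v: "v \<in> carrier_vec r" and 0: "transpose_mat X * X *\<^sub>v v = 0\<^sub>v r"
    have "(vec_norm (X *\<^sub>v v))\<^sup>2 = v \<bullet> (transpose_mat X * X *\<^sub>v v)"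
      using v by (simp add: vec_norm_power2 transpose_scalar_prod mult_assoc_vec_dim)
    then have "vec_norm (X *\<^sub>v v) = 0" using v 0 by simp
    then have "X *\<^sub>v v = 0\<^sub>v m" by (intro vec_norm_eq_0) (auto intro: carrier_vecI)
    then show "v = 0\<^sub>v r" using inj[OF v] by simp
  qed
  have [simp]: "dim_row K = r" "dim_col K = r" using K by auto
  have "transpose_mat K * (transpose_mat X * X) = transpose_mat (transpose_mat X * X * K)"
    by (simp add: transpose_mult_dim mult_assoc_dim)
  then have "transpose_mat K * (transpose_mat X * X) = 1\<^sub>m r" using K by simp
  then have "transpose_mat K * (transpose_mat X * X) * K = K" by simp
  then have "transpose_mat K = K" using K(2) by (simp add: mult_assoc_dim)
  then show ?thesis using K that by blast
qed

text \<open>\<open>Y\<^sup>T (Y Y\<^sup>T)\<^sup>-\<^sup>1 (X\<^sup>T X)\<^sup>-\<^sup>1 X\<^sup>T\<close> is the pseudo inverse of \<open>X Y\<close>.\<close>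

lemma rank_pseudo_inverse_exists:
  fixes X Y Z :: "real mat"
  assumes X: "X \<in> carrier_mat m r" and Y: "Y \<in> carrier_mat r n"
    and inj: "\<And>v. v \<in> carrier_vec r \<Longrightarrow> X *\<^sub>v v = 0\<^sub>v m \<Longrightarrow> v = 0\<^sub>v r"
    and Z: "Z \<in> carrier_mat n r" "Y * Z = 1\<^sub>m r"
  obtains W where "is_pseudo_inverse (X * Y) W" "Y * W * X = 1\<^sub>m r"
proof -
  have [simp]: "dim_row X = m" "dim_col X = r" "dim_row Y = r" "dim_col Y = n" using X Y by auto
  have Zd [simp]: "dim_row Z = n" "dim_col Z = r" using Z by auto
  obtain K where K: "K \<in> carrier_mat r r" "transpose_mat X * X * K = 1\<^sub>m r"
    "K * (transpose_mat X * X) = 1\<^sub>m r" "transpose_mat K = K"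
    using Gram_inverse[OF X inj] by blast
  have ZY: "transpose_mat Z * transpose_mat Y = 1\<^sub>m r"
    using Z(2) transpose_mult_dim[of Y Z] by simp
  have "v = 0\<^sub>v r" if v: "v \<in> carrier_vec r" and 0: "transpose_mat Y *\<^sub>v v = 0\<^sub>v n" for v
  proof -
    have "v = transpose_mat Z * transpose_mat Y *\<^sub>v v" unfolding ZY using v by simp
    also have "\<dots> = 0\<^sub>v r" using v by (simp add: mult_assoc_vec_dim 0 mult_vec_zero)
    finally show ?thesis .
  qed
  then obtain H where H: "H \<in> carrier_mat r r" "Y * transpose_mat Y * H = 1\<^sub>m r"
    "H * (Y * transpose_mat Y) = 1\<^sub>m r" "transpose_mat H = H"
    using Gram_inverse[of "transpose_mat Y" n r] Y by auto
  have [simp]: "dim_row K = r" "dim_col K = r" "dim_row H = r" "dim_col H = r" using K H by auto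
  have YH: "Y * (transpose_mat Y * H) = 1\<^sub>m r" and KX: "K * (transpose_mat X * X) = 1\<^sub>m r"
    using H(2) K(3) by (simp_all add: mult_assoc_dim)
  have YHC: "Y * (transpose_mat Y * (H * C)) = C" if "dim_row C = r" for C
  proof -
    have "Y * (transpose_mat Y * (H * C)) = Y * (transpose_mat Y * H) * C"
      using that by (simp add: mult_assoc_dim)
    then show ?thesis using that YH by simp
  qed
  have KXC: "K * (transpose_mat X * (X * C)) = C" if "dim_row C = r" for C
  proof -
    have "K * (transpose_mat X * (X * C)) = K * (transpose_mat X * X) * C"
      using that by (simp add: mult_assoc_dim)
    then show ?thesis using that KX by simp
  qed
  define W where "W = transpose_mat Y * (H * (K * transpose_mat X))"
  have W [simp]: "dim_row W = n" "dim_col W = m" by (simp_all add: W_def)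
  have 1: "X * Y * W = X * (K * transpose_mat X)"
    by (simp add: W_def mult_assoc_dim YHC)
  have 2: "W * (X * Y) = transpose_mat Y * (H * Y)"
    by (simp add: W_def mult_assoc_dim KXC)
  have "is_pseudo_inverse (X * Y) W"
    unfolding is_pseudo_inverse_def
  proof (intro conjI)
    show "W \<in> carrier_mat (dim_col (X * Y)) (dim_row (X * Y))" by (intro carrier_matI) auto
    show "X * Y * W * (X * Y) = X * Y" unfolding 1 by (simp add: mult_assoc_dim KXC)
    show "W * (X * Y) * W = W" unfolding 2 by (simp add: W_def mult_assoc_dim YHC)
    show "transpose_mat (X * Y * W) = X * Y * W"
      unfolding 1 using K(4) by (simp add: transpose_mult_dim mult_assoc_dim)
    show "transpose_mat (W * (X * Y)) = W * (X * Y)"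
      unfolding 2 using H(4) by (simp add: transpose_mult_dim mult_assoc_dim)
  qed
  moreover have "Y * W * X = 1\<^sub>m r"
    by (simp add: W_def mult_assoc_dim YHC KX)
  ultimately show ?thesis using that by blast
qed

section \<open>Perturbation of the pseudo inverse\<close>

text \<open>Wedin's constant: \<open>\<surd>2\<close> if a rank \<open>r\<close> matrix of size \<open>k \<times> l\<close> has full rank, and the golden
  ratio otherwise.\<close>

definition wedin_const :: "nat \<Rightarrow> nat \<Rightarrow> nat \<Rightarrow> real" where
  "wedin_const r k l = (if r = min k l then sqrt 2 else (1 + sqrt 5) / 2)"

text \<open>The largest eigenvalue of the form below is the square of the golden ratio.\<close>

lemma golden_ratio_quadratic_form:
  fixes c s :: real
  shows "(c + s)\<^sup>2 + c\<^sup>2 \<le> ((1 + sqrt 5) / 2)\<^sup>2 * (c\<^sup>2 + s\<^sup>2)"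
proof -
  define g where "g = (1 + sqrt 5) / (2 :: real)"
  have g2: "g\<^sup>2 = g + 1" by (simp add: g_def power2_eq_square field_simps)
  have "1 < sqrt (5 :: real)" by simp
  then have g1: "1 < g" unfolding g_def by (simp add: field_simps)
  \<comment> \<open>after multiplication by \<open>g\<close> the difference of the two sides is a perfect square\<close>
  have "g * (g\<^sup>2 * (c\<^sup>2 + s\<^sup>2) - ((c + s)\<^sup>2 + c\<^sup>2))
      = g * ((g - 1) * c\<^sup>2 - 2 * c * s + g * s\<^sup>2)"
    unfolding g2 by (simp add: power2_eq_square algebra_simps)
  also have "\<dots> = (g\<^sup>2 - g) * c\<^sup>2 - 2 * c * (g * s) + (g * s)\<^sup>2"
    by (simp add: power2_eq_square algebra_simps)
  also have "\<dots> = (c - g * s)\<^sup>2"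
    unfolding g2 by (simp add: power2_eq_square algebra_simps)
  finally have "0 \<le> g * (g\<^sup>2 * (c\<^sup>2 + s\<^sup>2) - ((c + s)\<^sup>2 + c\<^sup>2))" by simp
  then show ?thesis using g1 by (simp add: zero_le_mult_iff flip: g_def)
qed

lemma wedin_quadratic_form:
  fixes c s a b :: real
  assumes "0 \<le> a" "a \<le> c + s" "0 \<le> b" "b \<le> c" "r = min k l \<Longrightarrow> b = 0 \<or> s = 0"
  shows "a\<^sup>2 + b\<^sup>2 \<le> (wedin_const r k l)\<^sup>2 * (c\<^sup>2 + s\<^sup>2)"
proof -
  have a: "a\<^sup>2 \<le> (c + s)\<^sup>2" and b: "b\<^sup>2 \<le> c\<^sup>2" using assms by (auto intro: power_mono)
  show ?thesis
  proof (cases "r = min k l")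
    case True
    have "a\<^sup>2 + b\<^sup>2 \<le> 2 * (c\<^sup>2 + s\<^sup>2)"
    proof (cases "b = 0")
      case True
      have "0 \<le> (c - s)\<^sup>2" by simp
      then show ?thesis using a True by (simp add: power2_eq_square algebra_simps)
    next
      case False
      then show ?thesis using a b assms(5) \<open>r = min k l\<close> by simp
    qed
    then show ?thesis using True by (simp add: wedin_const_def)
  next
    case False
    then show ?thesis
      using a b golden_ratio_quadratic_form[of c s] by (simp add: wedin_const_def)
  qed
qed

text \<open>Wedin's theorem. Write \<open>x = x\<^sub>1 + x\<^sub>2\<close> with \<open>x\<^sub>1\<close> in the range of \<open>A\<close> and \<open>x\<^sub>2\<close> orthogonal to it, and
  split \<open>(W - U) x\<close> orthogonally by the projection \<open>W B\<close>:
  \<open>W B (W - U) x = W (B W) (1 - A U) x\<^sub>2 + W (A - B) U x\<^sub>1\<close> and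
  \<open>(1 - W B) (W - U) x = - (1 - W B) (U A) U x\<^sub>1\<close>.
  With \<open>\<alpha> = \<parallel>A - B\<parallel> \<parallel>U\<parallel> \<parallel>W\<parallel>\<close> the two parts are at most \<open>\<alpha> (|x\<^sub>1| + |x\<^sub>2|)\<close> and \<open>\<alpha> |x\<^sub>1|\<close>. For the products
  of two projections this uses the symmetry of the gap, which exchanges them for
  \<open>(1 - B W) A U = (1 - B W) (A - B) U\<close> and \<open>W B (1 - U A) = W (B - A) (1 - U A)\<close>. When the rank is
  full, \<open>x\<^sub>2\<close> or the second part vanishes.\<close>

theorem Wedin:
  assumes A: "A \<in> carrier_mat k l" and B: "B \<in> carrier_mat k l"
    and U: "rank_pseudo_inverse r A U" and W: "rank_pseudo_inverse r B W"
  shows "spectral_norm (W - U)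
    \<le> wedin_const r k l * (spectral_norm (A - B) * spectral_norm U * spectral_norm W)"
proof -
  have pU: "is_pseudo_inverse A U" and pW: "is_pseudo_inverse B W"
    using U W by (auto simp: rank_pseudo_inverse_def)
  have dims [simp]: "dim_row A = k" "dim_col A = l" "dim_row B = k" "dim_col B = l"
    "dim_row U = l" "dim_col U = k" "dim_row W = l" "dim_col W = k"
    using A B pU pW by (auto simp: is_pseudo_inverse_def)
  have UAU: "U * A * U = U" and BWB: "B * W * B = B" and WBW: "W * B * W = W" and AUA: "A * U * A = A"
    using pU pW by (auto simp: is_pseudo_inverse_def)
  have rAU: "rank_projection k r (A * U)" and rUA: "rank_projection l r (U * A)"
    and rBW: "rank_projection k r (B * W)" and rWB: "rank_projection l r (W * B)"
    using rank_pseudo_inverse_projections[OF U] rank_pseudo_inverse_projections[OF W] by auto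
  then have oAU: "orth_projection k (A * U)" and oUA: "orth_projection l (U * A)"
    and oBW: "orth_projection k (B * W)" and oWB: "orth_projection l (W * B)"
    by (auto simp: rank_projection_def)
  define e u w where "e = spectral_norm (A - B)" and "u = spectral_norm U" and "w = spectral_norm W"
  define \<alpha> where "\<alpha> = e * u * w"
  have nonneg [simp]: "0 \<le> e" "0 \<le> u" "0 \<le> w" "0 \<le> \<alpha>"
    by (auto simp: e_def u_def w_def \<alpha>_def)

  have "(1\<^sub>m k - B * W) * (A * U) = (1\<^sub>m k - B * W) * ((A - B) * U)"
  proof -
    have "B * W * (B * U) = B * U" using BWB by (simp flip: mult_assoc_dim)
    then show ?thesis by (simp add: diff_mult_dim mult_diff_dim) (intro eq_matI; simp)
  qed
  also have "spectral_norm \<dots> \<le> 1 * (e * u)"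
    using spectral_norm_orth_projection(2)[OF oBW]
    by (intro spectral_norm_mult_le) (auto simp: e_def u_def)
  finally have gap1: "spectral_norm ((1\<^sub>m k - B * W) * (A * U)) \<le> e * u" by simp
  have "B * W * (1\<^sub>m k - A * U) = transpose_mat ((1\<^sub>m k - A * U) * (B * W))"
    using oAU oBW by (simp add: orth_projection_def transpose_mult_dim[of "1\<^sub>m k - A * U"] transpose_diff_dim)
  then have "spectral_norm (B * W * (1\<^sub>m k - A * U)) = spectral_norm ((1\<^sub>m k - A * U) * (B * W))"
    by (simp add: spectral_norm_transpose)
  then have gap1': "spectral_norm (B * W * (1\<^sub>m k - A * U)) \<le> e * u"
    using projection_gap_le[OF rBW rAU] gap1 by simp

  have "W * B * (1\<^sub>m l - U * A) = W * ((B - A) * (1\<^sub>m l - U * A))"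
  proof -
    have "A * (U * A) = A" using AUA by (simp add: mult_assoc_dim)
    then have "A * (1\<^sub>m l - U * A) = 0\<^sub>m k l"
      by (simp add: mult_diff_dim) (intro eq_matI; simp)
    then have "(B - A) * (1\<^sub>m l - U * A) = B * (1\<^sub>m l - U * A)"
      by (simp add: diff_mult_dim) (intro eq_matI; simp)
    then show ?thesis by (simp add: mult_assoc_dim)
  qed
  also have "spectral_norm \<dots> \<le> w * (e * 1)"
    using spectral_norm_orth_projection(2)[OF oUA]
    by (intro spectral_norm_mult_le) (auto simp: e_def w_def spectral_norm_minus_commute[of B A])
  finally have gap2: "spectral_norm (W * B * (1\<^sub>m l - U * A)) \<le> w * e" by simp
  have "W * B * (1\<^sub>m l - U * A) = transpose_mat ((1\<^sub>m l - U * A) * (W * B))"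
    using oUA oWB by (simp add: orth_projection_def transpose_mult_dim[of "1\<^sub>m l - U * A"] transpose_diff_dim)
  then have "spectral_norm (W * B * (1\<^sub>m l - U * A)) = spectral_norm ((1\<^sub>m l - U * A) * (W * B))"
    by (simp add: spectral_norm_transpose)
  then have gap2': "spectral_norm ((1\<^sub>m l - W * B) * (U * A)) \<le> w * e"
    using projection_gap_le[OF rUA rWB] gap2 by simp

  have main: "vec_norm ((W - U) *\<^sub>v x) \<le> wedin_const r k l * \<alpha> * vec_norm x"
    if x: "x \<in> carrier_vec k" for x
  proof -
    have dx [simp]: "dim_vec x = k" using x by simp
    define x1 where "x1 = A * U *\<^sub>v x"
    define x2 where "x2 = x - x1"
    have [simp]: "dim_vec x1 = k" "dim_vec x2 = k" by (simp_all add: x1_def x2_def)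
    have x1x2: "(vec_norm x)\<^sup>2 = (vec_norm x1)\<^sup>2 + (vec_norm x2)\<^sup>2"
      using orth_projection_Pythagoras[OF oAU x] by (simp add: x1_def x2_def)
    have x2': "x2 = (1\<^sub>m k - A * U) *\<^sub>v x"
      using orth_projection_complement[OF oAU x] by (simp add: x1_def x2_def)
    have Ux1: "U *\<^sub>v x = U *\<^sub>v x1"
    proof -
      have "U *\<^sub>v x1 = U * A * U *\<^sub>v x" by (simp add: x1_def mult_assoc_vec_dim)
      then show ?thesis by (simp add: UAU)
    qed
    define y where "y = W *\<^sub>v x - U *\<^sub>v x"
    have y: "y \<in> carrier_vec l" and [simp]: "dim_vec y = l" by (auto simp: y_def intro: carrier_vecI)
    define y1 where "y1 = W * B *\<^sub>v y"
    have WBWx: "W *\<^sub>v (B *\<^sub>v (W *\<^sub>v x)) = W *\<^sub>v x"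
    proof -
      have "W *\<^sub>v (B *\<^sub>v (W *\<^sub>v x)) = W * B * W *\<^sub>v x" by (simp add: mult_assoc_vec_dim)
      then show ?thesis by (simp add: WBW)
    qed
    \<comment> \<open>the component of \<open>y\<close> in the range of \<open>W\<close>\<close>
    have "y1 = W *\<^sub>v x2 + W *\<^sub>v ((A - B) *\<^sub>v (U *\<^sub>v x1))"
    proof -
      have "y1 = W *\<^sub>v x - W *\<^sub>v (B *\<^sub>v (U *\<^sub>v x))"
        by (simp add: y1_def y_def mult_diff_vec_dim mult_assoc_vec_dim WBWx)
      moreover have "W *\<^sub>v ((A - B) *\<^sub>v (U *\<^sub>v x1)) = W *\<^sub>v x1 - W *\<^sub>v (B *\<^sub>v (U *\<^sub>v x))"
        unfolding Ux1[symmetric]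
        by (simp add: diff_mult_vec_dim mult_diff_vec_dim x1_def mult_assoc_vec_dim)
      moreover have "W *\<^sub>v x2 = W *\<^sub>v x - W *\<^sub>v x1" by (simp add: x2_def mult_diff_vec_dim)
      ultimately show ?thesis by (intro eq_vecI) auto
    qed
    moreover have "W *\<^sub>v x2 = W *\<^sub>v ((B * W * (1\<^sub>m k - A * U)) *\<^sub>v x2)"
    proof -
      have "(1\<^sub>m k - A * U) *\<^sub>v x2 = x2"
      proof -
        have "A * U *\<^sub>v x2 = A * U *\<^sub>v x - A * U *\<^sub>v (A * U *\<^sub>v x)"
          by (simp add: x2_def x1_def mult_diff_vec_dim)
        also have "\<dots> = 0\<^sub>v k"
          using orth_projection_idem[OF oAU x] by (intro eq_vecI) auto
        finally show ?thesis by (simp add: diff_mult_vec_dim carrier_vecI)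
      qed
      then have "W *\<^sub>v ((B * W * (1\<^sub>m k - A * U)) *\<^sub>v x2) = W *\<^sub>v (B * W *\<^sub>v x2)"
        by (simp add: mult_assoc_vec_dim)
      also have "\<dots> = W * B * W *\<^sub>v x2" by (simp add: mult_assoc_vec_dim)
      finally show ?thesis by (simp add: WBW)
    qed
    moreover have "vec_norm (W *\<^sub>v ((B * W * (1\<^sub>m k - A * U)) *\<^sub>v x2)) \<le> \<alpha> * vec_norm x2"
    proof -
      have "vec_norm (W *\<^sub>v ((B * W * (1\<^sub>m k - A * U)) *\<^sub>v x2))
          \<le> w * vec_norm ((B * W * (1\<^sub>m k - A * U)) *\<^sub>v x2)"
        unfolding w_def by (intro spectral_norm_bound) (auto intro: carrier_vecI)
      also have "\<dots> \<le> w * (spectral_norm (B * W * (1\<^sub>m k - A * U)) * vec_norm x2)"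
        by (intro mult_left_mono spectral_norm_bound) (auto intro: carrier_vecI)
      also have "\<dots> \<le> w * ((e * u) * vec_norm x2)"
        using gap1' by (intro mult_left_mono mult_right_mono) auto
      finally show ?thesis by (simp add: \<alpha>_def mult_ac)
    qed
    moreover have "vec_norm (W *\<^sub>v ((A - B) *\<^sub>v (U *\<^sub>v x1))) \<le> \<alpha> * vec_norm x1"
    proof -
      have "vec_norm (W *\<^sub>v ((A - B) *\<^sub>v (U *\<^sub>v x1))) \<le> w * vec_norm ((A - B) *\<^sub>v (U *\<^sub>v x1))"
        unfolding w_def by (intro spectral_norm_bound) (auto intro: carrier_vecI)
      also have "\<dots> \<le> w * (e * vec_norm (U *\<^sub>v x1))"
        unfolding e_def by (intro mult_left_mono spectral_norm_bound) (auto intro: carrier_vecI)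
      also have "\<dots> \<le> w * (e * (u * vec_norm x1))"
        unfolding u_def by (intro mult_left_mono spectral_norm_bound) (auto intro: carrier_vecI)
      finally show ?thesis by (simp add: \<alpha>_def mult_ac)
    qed
    ultimately have y1: "vec_norm y1 \<le> \<alpha> * vec_norm x1 + \<alpha> * vec_norm x2"
      using vec_norm_triangle[of "W *\<^sub>v x2" "W *\<^sub>v ((A - B) *\<^sub>v (U *\<^sub>v x1))"] by simp
    \<comment> \<open>the component of \<open>y\<close> orthogonal to the range of \<open>W\<close>\<close>
    have y2: "y - y1 = - ((1\<^sub>m l - W * B) * (U * A) *\<^sub>v (U *\<^sub>v x1))"
    proof -
      have "U * A *\<^sub>v (U *\<^sub>v x1) = U * A * U *\<^sub>v x1" by (simp add: mult_assoc_vec_dim)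
      then have "(1\<^sub>m l - W * B) * (U * A) *\<^sub>v (U *\<^sub>v x1) = (1\<^sub>m l - W * B) *\<^sub>v (U *\<^sub>v x1)"
        unfolding UAU by (simp add: mult_assoc_vec_dim)
      also have "\<dots> = U *\<^sub>v x - W *\<^sub>v (B *\<^sub>v (U *\<^sub>v x))"
        unfolding Ux1[symmetric] using orth_projection_complement[OF oWB, of "U *\<^sub>v x"]
        by (simp add: mult_assoc_vec_dim carrier_dim_vec del: carrier_vecD)
      moreover have "y1 = W *\<^sub>v x - W *\<^sub>v (B *\<^sub>v (U *\<^sub>v x))"
        by (simp add: y1_def y_def mult_diff_vec_dim mult_assoc_vec_dim WBWx)
      ultimately show ?thesis by (intro eq_vecI) (auto simp: y_def)
    qed
    have y2_le: "vec_norm (y - y1) \<le> \<alpha> * vec_norm x1"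
    proof -
      have "vec_norm (y - y1) \<le> spectral_norm ((1\<^sub>m l - W * B) * (U * A)) * vec_norm (U *\<^sub>v x1)"
        unfolding y2 vec_norm_uminus by (intro spectral_norm_bound) (auto intro: carrier_vecI)
      also have "\<dots> \<le> (w * e) * (u * vec_norm x1)"
        unfolding u_def using gap2' by (intro mult_mono spectral_norm_bound) (auto intro: carrier_vecI)
      finally show ?thesis by (simp add: \<alpha>_def mult_ac)
    qed
    have full: "vec_norm (y - y1) = 0 \<or> \<alpha> * vec_norm x2 = 0" if "r = min k l"
    proof (cases "r = k")
      case True
      then have "A * U = 1\<^sub>m k" using rank_projection_full rAU by blast
      then have "x1 = x" using x by (simp add: x1_def)
      then have "x2 = 0\<^sub>v k" unfolding x2_def by (intro eq_vecI) auto
      then show ?thesis by simp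
    next
      case False
      then have "r = l" using that by (auto simp: min_def split: if_splits)
      then have "W * B = 1\<^sub>m l" using rank_projection_full rWB by blast
      then have "y1 = y" using y by (simp add: y1_def)
      then have "y - y1 = 0\<^sub>v l" by (intro eq_vecI) auto
      then show ?thesis by simp
    qed
    have "(vec_norm y)\<^sup>2 = (vec_norm y1)\<^sup>2 + (vec_norm (y - y1))\<^sup>2"
      using orth_projection_Pythagoras[OF oWB y] by (simp add: y1_def)
    also have "\<dots> \<le> (wedin_const r k l)\<^sup>2 * ((\<alpha> * vec_norm x1)\<^sup>2 + (\<alpha> * vec_norm x2)\<^sup>2)"
      using y1 y2_le full by (intro wedin_quadratic_form) auto
    also have "\<dots> = (wedin_const r k l * \<alpha> * vec_norm x)\<^sup>2"
      by (simp add: power_mult_distrib x1x2 algebra_simps)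
    finally have "vec_norm y \<le> wedin_const r k l * \<alpha> * vec_norm x"
      by (rule power2_le_imp_le) (simp add: wedin_const_def)
    then show ?thesis by (simp add: y_def diff_mult_vec_dim)
  qed
  show ?thesis
    unfolding e_def[symmetric] u_def[symmetric] w_def[symmetric] \<alpha>_def[symmetric]
    using main by (intro spectral_norm_least) (auto simp: wedin_const_def)
qed

section \<open>Truncated singular value decompositions\<close>

lemma rect_diag_dims [simp]: "dim_row (rect_diag m n f) = m" "dim_col (rect_diag m n f) = n"
  by (auto simp: rect_diag_def)

lemma rect_diag_cong:
  "(\<And>i. i < m \<Longrightarrow> i < n \<Longrightarrow> f i = g i) \<Longrightarrow> rect_diag m n f = rect_diag m n g"
  unfolding rect_diag_def by (intro eq_matI) auto

lemma rect_diag_one: "rect_diag n n (\<lambda>_. 1) = 1\<^sub>m n"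
  unfolding rect_diag_def by (intro eq_matI) auto

lemma transpose_rect_diag: "transpose_mat (rect_diag m n f) = rect_diag n m f"
  unfolding rect_diag_def by (intro eq_matI) auto

lemma rect_diag_mult_vec:
  assumes "x \<in> carrier_vec n"
  shows "rect_diag m n f *\<^sub>v x = vec m (\<lambda>i. if i < n then f i * x $ i else 0)"
proof (rule eq_vecI)
  fix i assume "i < dim_vec (vec m (\<lambda>i. if i < n then f i * x $ i else 0))"
  then have i: "i < m" by simp
  have "(rect_diag m n f *\<^sub>v x) $ i = (\<Sum>j\<in>{0..<n}. (if i = j then f i else 0) * x $ j)"
    using i assms by (auto simp: rect_diag_def scalar_prod_def)
  also have "\<dots> = (\<Sum>j\<in>{0..<n}. if i = j then f i * x $ j else 0)"
    by (intro sum.cong) auto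
  also have "\<dots> = (if i < n then f i * x $ i else 0)"
    by (simp add: sum.delta')
  finally show "(rect_diag m n f *\<^sub>v x) $ i = vec m (\<lambda>i. if i < n then f i * x $ i else 0) $ i"
    using i by simp
qed simp

lemma rect_diag_mult:
  "rect_diag m n f * rect_diag n p g = rect_diag m p (\<lambda>i. if i < n then f i * g i else 0)"
proof (rule mat_eq_by_mult_vec)
  fix x :: "real vec" assume x: "x \<in> carrier_vec p"
  have "rect_diag m n f * rect_diag n p g *\<^sub>v x = rect_diag m n f *\<^sub>v (rect_diag n p g *\<^sub>v x)"
    using x by (simp add: mult_assoc_vec_dim)
  also have "\<dots> = rect_diag m p (\<lambda>i. if i < n then f i * g i else 0) *\<^sub>v x"
    using x by (intro eq_vecI) (auto simp: rect_diag_mult_vec)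
  finally show "rect_diag m n f * rect_diag n p g *\<^sub>v x
      = rect_diag m p (\<lambda>i. if i < n then f i * g i else 0) *\<^sub>v x" .
qed (auto intro: carrier_matI)

lemma vec_norm_rect_diag:
  assumes x: "x \<in> carrier_vec n"
  shows "(vec_norm (rect_diag m n f *\<^sub>v x))\<^sup>2 = (\<Sum>i<min m n. (f i)\<^sup>2 * (x $ i)\<^sup>2)"
proof -
  have "(vec_norm (rect_diag m n f *\<^sub>v x))\<^sup>2
      = (\<Sum>i\<in>{0..<m}. (if i < n then f i * x $ i else 0)\<^sup>2)"
    unfolding rect_diag_mult_vec[OF x] vec_norm_power2
    by (simp add: scalar_prod_def power2_eq_square)
  also have "\<dots> = (\<Sum>i<min m n. (if i < n then f i * x $ i else 0)\<^sup>2)"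
    by (rule sum.mono_neutral_right) auto
  also have "\<dots> = (\<Sum>i<min m n. (f i)\<^sup>2 * (x $ i)\<^sup>2)"
    by (intro sum.cong) (auto simp: power_mult_distrib)
  finally show ?thesis .
qed

lemma vec_norm_sum: "x \<in> carrier_vec n \<Longrightarrow> (vec_norm x)\<^sup>2 = (\<Sum>i<n. (x $ i)\<^sup>2)"
  unfolding vec_norm_power2 by (simp add: scalar_prod_def power2_eq_square atLeast0LessThan)

lemma spectral_norm_rect_diag_le:
  assumes "0 \<le> c" "\<And>i. i < min m n \<Longrightarrow> \<bar>f i\<bar> \<le> c"
  shows "spectral_norm (rect_diag m n f) \<le> c"
proof (rule spectral_norm_least)
  fix x :: "real vec" assume "x \<in> carrier_vec (dim_col (rect_diag m n f))"
  then have x: "x \<in> carrier_vec n" by simp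
  have "(vec_norm (rect_diag m n f *\<^sub>v x))\<^sup>2 \<le> (\<Sum>i<min m n. c\<^sup>2 * (x $ i)\<^sup>2)"
    unfolding vec_norm_rect_diag[OF x]
    using assms by (intro sum_mono mult_right_mono) (auto simp: abs_le_square_iff[symmetric])
  also have "\<dots> \<le> (\<Sum>i<n. c\<^sup>2 * (x $ i)\<^sup>2)" by (rule sum_mono2) auto
  also have "\<dots> = (c * vec_norm x)\<^sup>2"
    by (simp add: power_mult_distrib vec_norm_sum[OF x] sum_distrib_left)
  finally show "vec_norm (rect_diag m n f *\<^sub>v x) \<le> c * vec_norm x"
    by (rule power2_le_imp_le) (use assms(1) in simp)
qed (rule assms(1))

lemma sort_decreasing:
  assumes "sorted (rev ds)"
  shows "rev (sorted_list_of_multiset (mset ds)) = ds"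
proof -
  have "sorted_list_of_multiset (mset ds) = sorted_list_of_multiset (mset (rev ds))" by simp
  also have "\<dots> = rev ds" using assms by (subst sorted_list_of_multiset_mset) (rule sorted_sort_id)
  finally show ?thesis by simp
qed

lemma proots_linear_factors: "proots (\<Prod>a\<leftarrow>ds. [:- a, 1:]) = mset (ds :: real list)"
proof (induction ds)
  case (Cons d ds)
  have "(\<Prod>a\<leftarrow>ds. [:- a, 1:]) \<noteq> (0 :: real poly)" by (auto simp: prod_list_zero_iff)
  moreover have "[:- d, 1:] \<noteq> 0" by simp
  ultimately have "proots ([:- d, 1:] * (\<Prod>a\<leftarrow>ds. [:- a, 1:]))
      = proots [:- d, 1:] + proots (\<Prod>a\<leftarrow>ds. [:- a, 1:])"
    by (intro proots_mult)
  then show ?case using Cons.IH by simp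
qed simp

lemma orthogonal_rows:
  fixes Q :: "real mat"
  assumes "Q \<in> carrier_mat n n" "transpose_mat Q * Q = 1\<^sub>m n"
  shows "Q * transpose_mat Q = 1\<^sub>m n"
  using assms by (intro mat_mult_left_right_inverse[of "transpose_mat Q"]) auto

text \<open>With more columns than rows there is a kernel vector supported on the first \<open>r + 1\<close>
  coordinates: a row of zeros and rows that force the other coordinates to vanish complete the
  matrix to a singular square one.\<close>

lemma wide_kernel_vector:
  fixes Z :: "real mat"
  assumes Z: "Z \<in> carrier_mat r l" and rl: "r < l"
  obtains w where "w \<in> carrier_vec l" "w \<noteq> 0\<^sub>v l" "Z *\<^sub>v w = 0\<^sub>v r"
    "\<And>i. r < i \<Longrightarrow> i < l \<Longrightarrow> w $ i = 0"
proof -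
  define S where "S = mat l l (\<lambda>(i, j). if i < r then Z $$ (i, j) else if i \<noteq> r \<and> i = j then 1 else 0)"
  have S: "S \<in> carrier_mat l l" by (simp add: S_def)
  have "transpose_mat S *\<^sub>v unit_vec l r = 0\<^sub>v l"
    using rl by (intro eq_vecI) (auto simp: S_def scalar_prod_right_unit)
  moreover have "unit_vec l r \<in> carrier_vec l" "unit_vec l r \<noteq> (0\<^sub>v l :: real vec)"
    using rl by auto
  moreover have "transpose_mat S \<in> carrier_mat l l" using S by simp
  ultimately have "det (transpose_mat S) = 0" using det_0_iff_vec_prod_zero by blast
  then have "det S = 0" using S by (simp add: det_transpose)
  then obtain w where w: "w \<in> carrier_vec l" "w \<noteq> 0\<^sub>v l" "S *\<^sub>v w = 0\<^sub>v l"
    using det_0_iff_vec_prod_zero[OF S] by blast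
  have Sw: "row S i \<bullet> w = 0" if "i < l" for i
  proof -
    have "(S *\<^sub>v w) $ i = row S i \<bullet> w" using S that by simp
    then show ?thesis using w(3) that by simp
  qed
  have "Z *\<^sub>v w = 0\<^sub>v r"
  proof (rule eq_vecI)
    fix i assume "i < dim_vec (0\<^sub>v r :: real vec)"
    then have i: "i < r" by simp
    then have "row Z i = row S i" using Z rl by (intro eq_vecI) (auto simp: S_def)
    then show "(Z *\<^sub>v w) $ i = 0\<^sub>v r $ i" using Sw[of i] i rl Z by simp
  qed (use Z in simp)
  moreover have "w $ i = 0" if "r < i" "i < l" for i
  proof -
    have "row S i = unit_vec l i" using that by (intro eq_vecI) (auto simp: S_def)
    then show ?thesis using Sw[of i] that w(1) by simp
  qed
  ultimately show ?thesis using w(1,2) that by blast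
qed

context
  fixes G P Q :: "real mat" and s :: "nat \<Rightarrow> real" and k l :: nat
  assumes svd: "is_svd G P s Q" and G: "G \<in> carrier_mat k l"
begin

lemma svd_dims: "dim_row G = k" "dim_col G = l" "dim_row P = k" "dim_col P = k"
  "dim_row Q = l" "dim_col Q = l"
  using svd G by (auto simp: is_svd_def Let_def)

lemma svd_orthogonal: "transpose_mat P * P = 1\<^sub>m k" "transpose_mat Q * Q = 1\<^sub>m l"
  "P * transpose_mat P = 1\<^sub>m k" "Q * transpose_mat Q = 1\<^sub>m l"
  using svd G orthogonal_rows by (auto simp: is_svd_def Let_def)

lemma svd_eq: "G = P * rect_diag k l s * transpose_mat Q"
  using svd G by (simp add: is_svd_def Let_def)

lemma svd_nonneg: "i < min k l \<Longrightarrow> 0 \<le> s i"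
  using svd G by (simp add: is_svd_def Let_def)

lemma svd_decreasing: "i \<le> j \<Longrightarrow> j < min k l \<Longrightarrow> s j \<le> s i"
  using svd G by (auto simp: is_svd_def Let_def)

lemma svd_cancel:
  fixes C :: "real mat"
  shows "dim_row C = k \<Longrightarrow> transpose_mat P * (P * C) = C"
    "dim_row C = l \<Longrightarrow> transpose_mat Q * (Q * C) = C"
  using svd_orthogonal svd_dims by (simp_all flip: mult_assoc_dim)

text \<open>\<open>G\<^sup>T G\<close> is similar to a diagonal matrix with the entries \<open>s\<^sub>0\<^sup>2 \<ge> s\<^sub>1\<^sup>2 \<ge> \<dots>\<close>, padded by zeros.\<close>

lemma singular_value_svd:
  assumes "j < min k l"
  shows "singular_value G (Suc j) = s j"
proof -
  note [simp] = svd_dims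
  define d where "d = (\<lambda>i. if i < k then s i * s i else 0)"
  define D where "D = rect_diag l l d"
  have [simp]: "dim_row D = l" "dim_col D = l" by (simp_all add: D_def)
  have "transpose_mat G * G
      = Q * (rect_diag l k s * rect_diag k l s) * transpose_mat Q"
    unfolding svd_eq
    by (simp add: transpose_mult_dim transpose_rect_diag mult_assoc_dim svd_cancel)
  also have "rect_diag l k s * rect_diag k l s = D" by (simp add: rect_diag_mult D_def d_def)
  finally have "similar_mat (transpose_mat G * G) D"
    using svd_orthogonal by (intro similar_matI[of _ _ Q "transpose_mat Q" l]) (auto intro!: carrier_matI)
  then have "char_poly (transpose_mat G * G) = char_poly D" by (rule char_poly_similar)
  also have "\<dots> = (\<Prod>a\<leftarrow>diag_mat D. [:- a, 1:])"
    by (rule char_poly_upper_triangular[of _ l])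
      (auto intro!: carrier_matI simp: D_def rect_diag_def)
  also have "diag_mat D = map d [0..<l]"
    by (auto simp: diag_mat_def D_def rect_diag_def)
  finally have "proots (char_poly (transpose_mat G * G)) = mset (map d [0..<l])"
    by (simp only: proots_linear_factors)
  moreover have "sorted (rev (map d [0..<l]))"
    unfolding sorted_rev_iff_nth_mono
    using svd_nonneg svd_decreasing by (auto simp: d_def intro!: mult_mono)
  ultimately have "rev (sorted_list_of_multiset (proots (char_poly (transpose_mat G * G))))
      = map d [0..<l]"
    by (simp only: sort_decreasing)
  then show ?thesis
    using assms svd_nonneg[OF assms] by (simp add: singular_value_def d_def)
qed

lemma spectral_norm_svd_factors: "spectral_norm P \<le> 1" "spectral_norm (transpose_mat Q) \<le> 1"
proof -
  show "spectral_norm P \<le> 1"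
    using svd_orthogonal(1) by (intro spectral_norm_least) (auto simp: svd_dims vec_norm_isometry)
  have "spectral_norm Q \<le> 1"
    using svd_orthogonal(2) by (intro spectral_norm_least) (auto simp: svd_dims vec_norm_isometry)
  then show "spectral_norm (transpose_mat Q) \<le> 1" by (simp add: spectral_norm_transpose)
qed

text \<open>The pseudo inverse of a truncation is obtained by inverting the retained singular values.
  Since it annihilates the discarded part, it cannot tell \<open>G\<close> from its truncation.\<close>

lemma truncation_pseudo_inverse:
  assumes r: "0 < r" "r \<le> min k l" and pos: "0 < s (r - 1)"
    and Gr: "Gr = P * rect_diag k l (\<lambda>i. if i < r then s i else 0) * transpose_mat Q"
  obtains U where "rank_pseudo_inverse r Gr U" "U * G = U * Gr"
proof
  note [simp] = svd_dims
  have s: "s i \<noteq> 0" if "i < r" for i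
    using svd_decreasing[of i "r - 1"] that r pos by (cases r) auto
  define U where
    "U = Q * (rect_diag l k (\<lambda>i. if i < r then 1 / s i else 0) * transpose_mat P)"
  have [simp]: "dim_row U = l" "dim_col U = k" "dim_row Gr = k" "dim_col Gr = l"
    by (simp_all add: U_def Gr)
  define E where "E = (\<lambda>m. rect_diag m m (\<lambda>i. if i < r then 1 else 0))"
  have UGr: "U * Gr = Q * E l * transpose_mat Q" and GrU: "Gr * U = P * E k * transpose_mat P"
    and UG: "U * G = Q * E l * transpose_mat Q"
    unfolding U_def Gr svd_eq E_def using s r
    by (simp_all add: mult_assoc_dim svd_cancel rect_diag_mult mult_assoc_dim[symmetric, of "rect_diag _ _ _" "rect_diag _ _ _"])
      (intro arg_cong2[where f = "(*)"] refl rect_diag_cong; auto)+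
  show "U * G = U * Gr" using UG UGr by simp
  have "is_pseudo_inverse Gr U"
    unfolding is_pseudo_inverse_def
  proof (intro conjI)
    show "U \<in> carrier_mat (dim_col Gr) (dim_row Gr)" by (intro carrier_matI) simp_all
    show "Gr * U * Gr = Gr" "U * Gr * U = U"
      unfolding GrU UGr unfolding U_def Gr E_def using r
      by (simp_all add: mult_assoc_dim svd_cancel rect_diag_mult mult_assoc_dim[symmetric, of "rect_diag _ _ _" "rect_diag _ _ _"])
        (intro arg_cong2[where f = "(*)"] refl rect_diag_cong; auto)+
    show "transpose_mat (Gr * U) = Gr * U" "transpose_mat (U * Gr) = U * Gr"
      unfolding GrU UGr E_def
      by (simp_all add: transpose_mult_dim transpose_rect_diag mult_assoc_dim)
  qed
  moreover define X where "X = P * rect_diag k r (\<lambda>_. 1)"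
  moreover define Y where "Y = rect_diag r l s * transpose_mat Q"
  moreover have "X \<in> carrier_mat k r" "Y \<in> carrier_mat r l"
    by (auto simp: X_def Y_def)
  moreover have "Gr = X * Y"
    unfolding X_def Y_def Gr
    by (simp add: mult_assoc_dim rect_diag_mult mult_assoc_dim[symmetric, of "rect_diag _ _ _" "rect_diag _ _ _"])
      (intro arg_cong2[where f = "(*)"] refl rect_diag_cong; auto)
  moreover have "Y * U * X = 1\<^sub>m r"
    unfolding X_def Y_def U_def rect_diag_one[symmetric] using r s
    by (simp add: mult_assoc_dim svd_cancel rect_diag_mult mult_assoc_dim[symmetric, of "rect_diag _ _ _" "rect_diag _ _ _"]
        cong: rect_diag_cong)
  ultimately show "rank_pseudo_inverse r Gr U"
    unfolding rank_pseudo_inverse_def by auto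
qed

text \<open>Eckart and Young: no matrix of rank at most \<open>r\<close> is closer to \<open>G\<close> than the truncation. Such a
  matrix annihilates a nonzero combination of the first \<open>r + 1\<close> right singular vectors, which \<open>G\<close> stretches by at least \<open>s r\<close>.\<close>

lemma truncation_error_le:
  assumes r: "r \<le> min k l"
    and Gr: "Gr = P * rect_diag k l (\<lambda>i. if i < r then s i else 0) * transpose_mat Q"
    and X: "X \<in> carrier_mat k r" and Y: "Y \<in> carrier_mat r l"
  shows "spectral_norm (G - Gr) \<le> spectral_norm (G - X * Y)"
proof -
  note [simp] = svd_dims
  have [simp]: "dim_row X = k" "dim_col X = r" "dim_row Y = r" "dim_col Y = l" using X Y by auto
  \<comment> \<open>the norm of the discarded part; nothing is discarded if \<open>r = min k l\<close>\<close>
  define c where "c = (if r < min k l then s r else 0)"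
  have c: "0 \<le> c" using svd_nonneg by (auto simp: c_def)
  define D where "D = rect_diag k l (\<lambda>i. if i < r then 0 else s i)"
  have [simp]: "dim_row D = k" "dim_col D = l" by (simp_all add: D_def)
  have "G - Gr = P * ((rect_diag k l s - rect_diag k l (\<lambda>i. if i < r then s i else 0)) * transpose_mat Q)"
    unfolding svd_eq Gr by (simp add: mult_assoc_dim diff_mult_dim mult_diff_dim)
  also have "rect_diag k l s - rect_diag k l (\<lambda>i. if i < r then s i else 0) = D"
    unfolding D_def rect_diag_def by (intro eq_matI) auto
  also have "spectral_norm (P * (D * transpose_mat Q)) \<le> 1 * (c * 1)"
  proof (intro spectral_norm_mult_le spectral_norm_svd_factors)
    show "spectral_norm D \<le> c" unfolding D_def
    proof (rule spectral_norm_rect_diag_le[OF c])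
      fix i assume i: "i < min k l"
      show "\<bar>if i < r then 0 else s i\<bar> \<le> c"
        using c i svd_nonneg[OF i] svd_decreasing[of r i] by (auto simp: c_def)
    qed
  qed auto
  finally have upper: "spectral_norm (G - Gr) \<le> c" by simp
  show ?thesis
  proof (cases "r < min k l")
    case False
    then have "c = 0" by (auto simp: c_def)
    then show ?thesis using upper spectral_norm_nonneg[of "G - X * Y"] by linarith
  next
    case True
    obtain w where w: "w \<in> carrier_vec l" "w \<noteq> 0\<^sub>v l" "Y * Q *\<^sub>v w = 0\<^sub>v r"
      and w0: "\<And>i. r < i \<Longrightarrow> i < l \<Longrightarrow> w $ i = 0"
    proof (rule wide_kernel_vector)
      show "Y * Q \<in> carrier_mat r l" by (intro carrier_matI) auto
      show "r < l" using True by simp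
    qed blast
    define z where "z = Q *\<^sub>v w"
    have z: "z \<in> carrier_vec l" "dim_vec z = l" by (auto simp: z_def intro: carrier_vecI)
    have Yz: "Y *\<^sub>v z = 0\<^sub>v r" using w(1,3) by (simp add: z_def mult_assoc_vec_dim)
    have XYz: "X * Y *\<^sub>v z = 0\<^sub>v k" using z Yz by (simp add: mult_assoc_vec_dim mult_vec_zero)
    have "transpose_mat Q *\<^sub>v z = w"
      using w(1) svd_orthogonal(2) by (simp add: z_def flip: mult_assoc_vec_dim)
    then have Gz: "G *\<^sub>v z = P *\<^sub>v (rect_diag k l s *\<^sub>v w)"
      unfolding svd_eq using z w(1) by (simp add: mult_assoc_vec_dim)
    have "(G - X * Y) *\<^sub>v z = P *\<^sub>v (rect_diag k l s *\<^sub>v w)"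
      using z by (simp add: diff_mult_vec_dim XYz Gz) (intro eq_vecI; simp)
    then have "vec_norm ((G - X * Y) *\<^sub>v z) = vec_norm (rect_diag k l s *\<^sub>v w)"
      using svd_orthogonal(1) by (simp add: vec_norm_isometry carrier_vecI)
    moreover have "vec_norm z = vec_norm w"
      unfolding z_def using svd_orthogonal(2) w(1) by (simp add: vec_norm_isometry)
    ultimately have lower: "vec_norm (rect_diag k l s *\<^sub>v w) \<le> spectral_norm (G - X * Y) * vec_norm w"
      using spectral_norm_bound[of z "G - X * Y"] z by simp
    have "(c * vec_norm w)\<^sup>2 = (\<Sum>i<l. c\<^sup>2 * (w $ i)\<^sup>2)"
      by (simp add: power_mult_distrib vec_norm_sum[OF w(1)] sum_distrib_left)
    also have "\<dots> = (\<Sum>i<min k l. c\<^sup>2 * (w $ i)\<^sup>2)"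
      using w0 True by (intro sum.mono_neutral_right) auto
    also have "\<dots> \<le> (\<Sum>i<min k l. (s i)\<^sup>2 * (w $ i)\<^sup>2)"
    proof (rule sum_mono)
      fix i assume "i \<in> {..<min k l}"
      then have i: "i < min k l" by simp
      show "c\<^sup>2 * (w $ i)\<^sup>2 \<le> (s i)\<^sup>2 * (w $ i)\<^sup>2"
      proof (cases "r < i")
        case False
        then have "c \<le> s i" using True svd_decreasing[of i r] by (simp add: c_def)
        then show ?thesis using c by (intro mult_right_mono power_mono) auto
      qed (use w0 i in auto)
    qed
    also have "\<dots> = (vec_norm (rect_diag k l s *\<^sub>v w))\<^sup>2" by (simp add: vec_norm_rect_diag[OF w(1)])
    finally have "c * vec_norm w \<le> vec_norm (rect_diag k l s *\<^sub>v w)" by (rule power2_le_imp_le) simp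
    with lower have "c * vec_norm w \<le> spectral_norm (G - X * Y) * vec_norm w" by linarith
    moreover have "vec_norm w \<noteq> 0" using w vec_norm_eq_0 by blast
    then have "0 < vec_norm w" using vec_norm_nonneg[of w] by linarith
    ultimately have "c \<le> spectral_norm (G - X * Y)" by (rule mult_right_le_imp_le)
    then show ?thesis using upper by linarith
  qed
qed

end

section \<open>Rank factorization and submatrices\<close>

text \<open>A basis of the column space, chosen among the columns, supplies the left factor.\<close>

lemma rank_factorization:
  fixes A :: "real mat"
  assumes A: "A \<in> carrier_mat m n" and rank: "vec_space.rank m A = r"
  obtains X Y where "X \<in> carrier_mat m r" "Y \<in> carrier_mat r n" "A = X * Y"
proof -
  interpret vec_space "TYPE(real)" m .
  have cols: "set (cols A) \<subseteq> carrier_vec m" using cols_dim A by blast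
  obtain S where S: "finite S" "maximal S (\<lambda>T. T \<subseteq> set (cols A) \<and> lin_indpt T)"
    using maximal_exists_superset[of "set (cols A)" "\<lambda>T. T \<subseteq> set (cols A) \<and> lin_indpt T" "{}"]
    by (auto simp: lin_dep_def)
  have card: "card S = r" using rank_card_indpt[OF A S(2)] rank by simp
  have S': "S \<subseteq> set (cols A)" "lin_indpt S" using S(2) by (auto simp: maximal_def)
  then have SC: "S \<subseteq> carrier_vec m" using cols by blast
  obtain ws where ws: "set ws = S" "distinct ws" using S(1) finite_distinct_list by blast
  then have len: "length ws = r" using card distinct_card by fastforce
  define X where "X = mat_of_cols m ws"
  have X: "X \<in> carrier_mat m r" by (simp add: X_def len flip: len)
  have "\<exists>c\<in>carrier_vec r. X *\<^sub>v c = a" if a: "a \<in> set (cols A)" for a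
  proof -
    have am: "a \<in> carrier_vec m" using a cols by blast
    have "a \<in> span S"
    proof (rule ccontr)
      assume no: "a \<notin> span S"
      then have "a \<notin> S" using span_mem[OF SC] by blast
      then have "lin_indpt (S \<union> {a})" using lin_dep_iff_in_span[OF SC S'(2) am] no by blast
      then have "S \<union> {a} = S" using S(2) a S'(1) unfolding maximal_def by blast
      then show False using \<open>a \<notin> S\<close> by blast
    qed
    then obtain f where "lincomb f S = a" using finite_in_span[OF S(1) SC] by blast
    then have "a = lincomb_list (\<lambda>i. f (ws ! i)) ws"
      using lincomb_as_lincomb_list_distinct[of ws f] ws SC by simp
    also have "\<dots> = X *\<^sub>v vec r (\<lambda>i. f (ws ! i))"
    proof -
      have "\<forall>w\<in>set ws. dim_vec w = m" using ws(1) SC by auto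
      then show ?thesis unfolding X_def using lincomb_list_as_mat_mult[of ws] len by simp
    qed
    finally show ?thesis by (intro bexI[of _ "vec r (\<lambda>i. f (ws ! i))"]) auto
  qed
  moreover have "col A j \<in> set (cols A)" if "j < n" for j
    using A that by (metis carrier_matD(2) cols_length cols_nth nth_mem)
  ultimately have "\<exists>c. \<forall>j<n. c j \<in> carrier_vec r \<and> X *\<^sub>v c j = col A j" by (intro choice) blast
  then obtain c where c: "\<And>j. j < n \<Longrightarrow> c j \<in> carrier_vec r" "\<And>j. j < n \<Longrightarrow> X *\<^sub>v c j = col A j"
    by blast
  define Y where "Y = mat r n (\<lambda>(i, j). c j $ i)"
  have Y: "Y \<in> carrier_mat r n" by (simp add: Y_def)
  have "A = X * Y"
  proof (rule mat_col_eqI)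
    fix j assume "j < dim_col (X * Y)"
    then have j: "j < n" by (simp add: Y_def)
    have "col Y j = c j" using c(1)[OF j] j by (intro eq_vecI) (auto simp: Y_def)
    then show "col A j = col (X * Y) j" using col_mult2[OF X Y j] c(2)[OF j] by simp
  qed (use A X Y in auto)
  then show ?thesis using that X Y by blast
qed

text \<open>Multiplication by selectors turns taking a submatrix into a compression \<open>S M T\<close> by
  contractions.\<close>

definition row_selector :: "nat \<Rightarrow> nat set \<Rightarrow> real mat" where
  "row_selector m I = mat (card I) m (\<lambda>(i, j). if j = pick I i then 1 else 0)"

context
  fixes I :: "nat set" and m :: nat
  assumes I: "I \<subseteq> {..<m}"
begin

lemma row_selector_carrier: "row_selector m I \<in> carrier_mat (card I) m"
  by (simp add: row_selector_def)

lemma row_selector_restrict: "{i. i < m \<and> i \<in> I} = I"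
  using I by auto

lemma pick_less: "i < card I \<Longrightarrow> pick I i < m"
  using pick_in_set_le I by blast

lemma row_row_selector: "i < card I \<Longrightarrow> row (row_selector m I) i = unit_vec m (pick I i)"
  using pick_less by (intro eq_vecI) (auto simp: row_selector_def unit_vec_def)

lemma submatrix_rows:
  fixes M :: "real mat"
  assumes "dim_row M = m"
  shows "submatrix M I UNIV = row_selector m I * M"
proof (rule eq_matI)
  fix i j assume "i < dim_row (row_selector m I * M)" "j < dim_col (row_selector m I * M)"
  then have ij: "i < card I" "j < dim_col M" using row_selector_carrier by auto
  have "(row_selector m I * M) $$ (i, j) = unit_vec m (pick I i) \<bullet> col M j"
    using ij row_selector_carrier row_row_selector by simp
  also have "\<dots> = M $$ (pick I i, j)"
    using assms ij pick_less by (subst scalar_prod_left_unit[of _ m]) (auto intro: carrier_vecI)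
  finally show "submatrix M I UNIV $$ (i, j) = (row_selector m I * M) $$ (i, j)"
    using assms ij by (subst submatrix_index) (auto simp: row_selector_restrict pick_UNIV)
qed (use assms row_selector_carrier in \<open>auto simp: dim_submatrix row_selector_restrict\<close>)

lemma submatrix_cols:
  fixes M :: "real mat"
  assumes "dim_col M = m"
  shows "submatrix M UNIV I = M * transpose_mat (row_selector m I)"
proof (rule eq_matI)
  fix i j assume "i < dim_row (M * transpose_mat (row_selector m I))"
    "j < dim_col (M * transpose_mat (row_selector m I))"
  then have ij: "i < dim_row M" "j < card I" using row_selector_carrier by auto
  have "(M * transpose_mat (row_selector m I)) $$ (i, j) = row M i \<bullet> unit_vec m (pick I j)"
    using ij row_selector_carrier row_row_selector by simp
  also have "\<dots> = M $$ (i, pick I j)"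
    using assms ij pick_less by (subst scalar_prod_right_unit[of _ m]) (auto intro: carrier_vecI)
  finally show "submatrix M UNIV I $$ (i, j) = (M * transpose_mat (row_selector m I)) $$ (i, j)"
    using assms ij by (subst submatrix_index) (auto simp: row_selector_restrict pick_UNIV)
qed (use assms row_selector_carrier in \<open>auto simp: dim_submatrix row_selector_restrict\<close>)

lemma spectral_norm_row_selector: "spectral_norm (row_selector m I) \<le> 1"
proof -
  let ?S = "row_selector m I"
  have [simp]: "dim_row ?S = card I" "dim_col ?S = m" using row_selector_carrier by auto
  have "?S * transpose_mat ?S = 1\<^sub>m (card I)"
  proof (rule eq_matI)
    fix i j assume "i < dim_row (1\<^sub>m (card I) :: real mat)" "j < dim_col (1\<^sub>m (card I) :: real mat)"
    then have ij: "i < card I" "j < card I" by auto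
    have "(?S * transpose_mat ?S) $$ (i, j) = unit_vec m (pick I i) \<bullet> unit_vec m (pick I j)"
      using ij row_row_selector by simp
    also have "\<dots> = (if pick I i = pick I j then 1 else 0)"
      using ij pick_less by (subst scalar_prod_left_unit[of _ m]) auto
    also have "pick I i = pick I j \<longleftrightarrow> i = j"
      using ij pick_mono_le by (metis less_irrefl linorder_neqE_nat)
    finally show "(?S * transpose_mat ?S) $$ (i, j) = 1\<^sub>m (card I) $$ (i, j)" using ij by simp
  qed auto
  then have "spectral_norm (transpose_mat ?S) \<le> 1"
    by (intro spectral_norm_least) (auto simp: vec_norm_isometry[of _ "card I"])
  then show ?thesis by (simp add: spectral_norm_transpose)
qed

end

section \<open>The error bound\<close>

text \<open>If \<open>A\<close> has rank \<open>r\<close> and its pseudo inverse \<open>U\<close> does not tell \<open>G\<close> from \<open>A\<close>, then a product \<open>X Y\<close>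
  with inner dimension \<open>r\<close> that is close to \<open>G\<close> has rank \<open>r\<close> too, and a pseudo inverse that is
  larger than \<open>U\<close> by a factor of at most \<open>1 / (1 - \<theta>)\<close>, where \<open>\<theta> = \<epsilon> \<parallel>U\<parallel>\<close>.
  As \<open>U G V = V\<close> for a matrix \<open>V\<close> whose columns span the range of \<open>U\<close>, the matrix \<open>G\<close>, and by closeness \<open>X Y\<close> as well, is bounded below on this
  range: \<open>(1 - \<theta>) |v| \<le> \<parallel>U\<parallel> |X Y v|\<close>. A vector in the row space of \<open>X Y\<close> is the orthogonal
  projection of a \<open>v\<close> in this range with the same image, and is not longer than \<open>v\<close>.\<close>

lemma nearby_pseudo_inverse:
  assumes G: "G \<in> carrier_mat k l" and A: "A \<in> carrier_mat k l"
    and U: "rank_pseudo_inverse r A U" and UG: "U * G = U * A"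
    and X: "X \<in> carrier_mat k r" and Y: "Y \<in> carrier_mat r l"
    and near: "spectral_norm (G - X * Y) \<le> \<epsilon>" and \<theta>: "\<epsilon> * spectral_norm U < 1"
  obtains W where "is_pseudo_inverse (X * Y) W" "Y * W * X = 1\<^sub>m r"
    "(1 - \<epsilon> * spectral_norm U) * spectral_norm W \<le> spectral_norm U"
proof -
  define u where "u = spectral_norm U"
  define \<theta> where "\<theta> = \<epsilon> * u"
  have \<theta>1: "\<theta> < 1" using \<theta> by (simp add: \<theta>_def u_def)
  have u0 [simp]: "0 \<le> u" by (simp add: u_def)
  have pU: "is_pseudo_inverse A U" using U by (simp add: rank_pseudo_inverse_def)
  obtain X' Y' where XY': "X' \<in> carrier_mat k r" "Y' \<in> carrier_mat r l"
    "A = X' * Y'" "Y' * U * X' = 1\<^sub>m r"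
    using U A unfolding rank_pseudo_inverse_def by auto
  have [simp]: "dim_row G = k" "dim_col G = l" "dim_row A = k" "dim_col A = l"
    "dim_row X = k" "dim_col X = r" "dim_row Y = r" "dim_col Y = l"
    "dim_row X' = k" "dim_col X' = r" "dim_row Y' = r" "dim_col Y' = l"
    "dim_row U = l" "dim_col U = k"
    using G A X Y XY'(1,2) pU by (auto simp: is_pseudo_inverse_def)
  define V where "V = U * X'"
  have [simp]: "dim_row V = l" "dim_col V = r" by (simp_all add: V_def)
  have Y'V: "Y' * V = 1\<^sub>m r" using XY'(4) by (simp add: V_def mult_assoc_dim)
  have UGV: "U * G * V = V"
  proof -
    have "U * G * V = U * (X' * (Y' * V))" unfolding UG by (simp add: XY'(3) mult_assoc_dim)
    then show ?thesis unfolding Y'V by (simp add: V_def)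
  qed
  have below: "(1 - \<theta>) * vec_norm (V *\<^sub>v w) \<le> u * vec_norm (X * Y *\<^sub>v (V *\<^sub>v w))"
    if w: "w \<in> carrier_vec r" for w
  proof -
    define v where "v = V *\<^sub>v w"
    have v: "v \<in> carrier_vec l" "dim_vec v = l" by (auto simp: v_def intro: carrier_vecI)
    have "v = U * G * V *\<^sub>v w" unfolding UGV by (simp add: v_def)
    also have "\<dots> = U *\<^sub>v (G *\<^sub>v v)" using w by (simp add: v_def mult_assoc_vec_dim)
    finally have "vec_norm v = vec_norm (U *\<^sub>v (G *\<^sub>v v))" by simp
    also have "\<dots> \<le> u * vec_norm (G *\<^sub>v v)"
      unfolding u_def by (intro spectral_norm_bound) (auto intro: carrier_vecI)
    finally have "vec_norm v \<le> u * vec_norm (G *\<^sub>v v)" .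
    also have "G *\<^sub>v v = (G - X * Y) *\<^sub>v v + X * Y *\<^sub>v v"
      using v(2) by (simp add: diff_mult_vec_dim) (intro eq_vecI; simp)
    also have "u * vec_norm \<dots> \<le> u * (\<epsilon> * vec_norm v + vec_norm (X * Y *\<^sub>v v))"
    proof (intro mult_left_mono u0)
      have "vec_norm ((G - X * Y) *\<^sub>v v) \<le> spectral_norm (G - X * Y) * vec_norm v"
        using v by (intro spectral_norm_bound) simp
      also have "\<dots> \<le> \<epsilon> * vec_norm v" using near by (intro mult_right_mono) auto
      finally show "vec_norm ((G - X * Y) *\<^sub>v v + X * Y *\<^sub>v v) \<le> \<epsilon> * vec_norm v + vec_norm (X * Y *\<^sub>v v)"
        using vec_norm_triangle[of "(G - X * Y) *\<^sub>v v" "X * Y *\<^sub>v v"] by simp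
    qed
    finally show ?thesis by (simp add: v_def[symmetric] \<theta>_def algebra_simps)
  qed

  have inj: "w = 0\<^sub>v r" if w: "w \<in> carrier_vec r" and 0: "X * Y *\<^sub>v (V *\<^sub>v w) = 0\<^sub>v k" for w
  proof -
    have "(1 - \<theta>) * vec_norm (V *\<^sub>v w) \<le> 0" using below[OF w] 0 by simp
    then have "vec_norm (V *\<^sub>v w) \<le> 0" using \<theta>1 by (simp add: mult_le_0_iff)
    then have "vec_norm (V *\<^sub>v w) = 0" using vec_norm_nonneg[of "V *\<^sub>v w"] by linarith
    then have "V *\<^sub>v w = 0\<^sub>v l" by (intro vec_norm_eq_0 carrier_vecI) auto
    then have "Y' * V *\<^sub>v w = 0\<^sub>v r" using w by (simp add: mult_assoc_vec_dim mult_vec_zero)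
    then show ?thesis using w by (simp add: Y'V)
  qed
  have "Y * V \<in> carrier_mat r r" by (intro carrier_matI) auto
  then obtain H where H: "H \<in> carrier_mat r r" "Y * V * H = 1\<^sub>m r"
  proof (rule inverse_of_injective)
    fix w :: "real vec" assume w: "w \<in> carrier_vec r" "Y * V *\<^sub>v w = 0\<^sub>v r"
    then have "Y *\<^sub>v (V *\<^sub>v w) = 0\<^sub>v r" by (simp add: mult_assoc_vec_dim)
    then show "w = 0\<^sub>v r" using inj[OF w(1)] by (simp add: mult_assoc_vec_dim mult_vec_zero)
  qed blast
  have [simp]: "dim_row H = r" "dim_col H = r" using H by auto
  have YVH: "Y * (V * H) = 1\<^sub>m r" using H(2) by (simp add: mult_assoc_dim)
  have Xinj: "w = 0\<^sub>v r" if w: "w \<in> carrier_vec r" and 0: "X *\<^sub>v w = 0\<^sub>v k" for w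
  proof -
    have "w = Y *\<^sub>v (V *\<^sub>v (H *\<^sub>v w))"
    proof -
      have "Y *\<^sub>v (V *\<^sub>v (H *\<^sub>v w)) = Y * V * H *\<^sub>v w" using w by (simp add: mult_assoc_vec_dim)
      then show ?thesis unfolding H(2) using w by simp
    qed
    then have "X * Y *\<^sub>v (V *\<^sub>v (H *\<^sub>v w)) = 0\<^sub>v k" using 0 by (simp add: mult_assoc_vec_dim)
    then have "H *\<^sub>v w = 0\<^sub>v r" by (intro inj carrier_vecI) auto
    then have "Y * V * H *\<^sub>v w = 0\<^sub>v r" using w by (simp add: mult_assoc_vec_dim mult_vec_zero)
    then show ?thesis unfolding H(2) using w by simp
  qed
  have Z: "V * H \<in> carrier_mat l r" by (intro carrier_matI) auto
  obtain W where W: "is_pseudo_inverse (X * Y) W" "Y * W * X = 1\<^sub>m r"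
    using rank_pseudo_inverse_exists[OF X Y Xinj Z YVH] by blast
  define B where "B = X * Y"
  have dims [simp]: "dim_row B = k" "dim_col B = l" "dim_row W = l" "dim_col W = k"
    using W(1) by (auto simp: B_def is_pseudo_inverse_def)
  have oBW: "orth_projection k (B * W)" and oWB: "orth_projection l (W * B)"
    using pseudo_inverse_projections[OF W(1)] by (auto simp: B_def)
  have "vec_norm (W *\<^sub>v y) \<le> u / (1 - \<theta>) * vec_norm y" if y: "y \<in> carrier_vec k" for y
  proof -
    have [simp]: "dim_vec y = k" using y by simp
    define x where "x = W *\<^sub>v y"
    have x: "dim_vec x = l" by (simp add: x_def)
    define v where "v = V *\<^sub>v (H *\<^sub>v (Y *\<^sub>v x))"
    have v: "v \<in> carrier_vec l" "dim_vec v = l" by (auto simp: v_def intro: carrier_vecI)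
    have "Y *\<^sub>v v = Y * V * H *\<^sub>v (Y *\<^sub>v x)" by (simp add: v_def mult_assoc_vec_dim)
    moreover have "Y *\<^sub>v x \<in> carrier_vec r" by (auto intro: carrier_vecI)
    ultimately have Yv: "Y *\<^sub>v v = Y *\<^sub>v x" unfolding H(2) by simp
    then have Bv: "B *\<^sub>v v = B *\<^sub>v x" using v x by (simp add: B_def mult_assoc_vec_dim)
    have "W * B *\<^sub>v v = W *\<^sub>v (B *\<^sub>v x)" using v by (simp add: mult_assoc_vec_dim Bv)
    also have "\<dots> = W * B * W *\<^sub>v y" by (simp add: x_def mult_assoc_vec_dim)
    also have "\<dots> = x" using W(1) by (simp add: B_def is_pseudo_inverse_def x_def)
    finally have "vec_norm x \<le> vec_norm v" using orth_projection_contracts(1)[OF oWB v(1)] by simp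
    then have "(1 - \<theta>) * vec_norm x \<le> (1 - \<theta>) * vec_norm v" using \<theta>1 by (intro mult_left_mono) auto
    also have "\<dots> \<le> u * vec_norm (B *\<^sub>v v)"
      unfolding v_def B_def by (rule below) (auto intro: carrier_vecI)
    also have "B *\<^sub>v v = B * W *\<^sub>v y" by (simp add: Bv) (simp add: x_def mult_assoc_vec_dim)
    also have "u * vec_norm \<dots> \<le> u * vec_norm y"
      using orth_projection_contracts(1)[OF oBW y] by (intro mult_left_mono) auto
    finally show ?thesis using \<theta>1 by (simp add: x_def field_simps)
  qed
  then have "spectral_norm W \<le> u / (1 - \<theta>)"
    using \<theta>1 by (intro spectral_norm_least) auto
  then have "(1 - \<theta>) * spectral_norm W \<le> u" using \<theta>1 by (simp add: field_simps)
  then show ?thesis using that W by (simp add: \<theta>_def u_def)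
qed

text \<open>Of the submatrices only this matters: \<open>G = S M T\<close>, \<open>C = M T\<close> and \<open>R = S M\<close> with contractions \<open>S\<close>
  and \<open>T\<close>. Put \<open>M' = L N\<close>, \<open>C' = M' T\<close>, \<open>R' = S M'\<close>, and let \<open>W\<close> be the pseudo inverse of \<open>S M' T\<close>.
  As \<open>S M' T\<close> has rank \<open>r\<close>, it determines \<open>M' = C' W R'\<close> exactly, so that
  \<open>M - C U R = (M - M') + (C' - C) U R + C' U (R' - R) + C' (W - U) R'\<close>.
  The last term is controlled by Wedin's theorem, \<open>\<parallel>W\<parallel> \<le> \<parallel>U\<parallel> / (1 - \<theta>)\<close> and
  \<open>\<parallel>A - S M' T\<parallel> \<le> \<parallel>A - G\<parallel> + \<parallel>G - S M' T\<parallel> \<le> 2 \<epsilon>\<close>. With the primed factors on the outside only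
  \<open>\<parallel>C'\<parallel> \<parallel>U\<parallel> \<le> v + \<theta> \<le> v + 1\<close> and the same bound for \<open>R'\<close> are needed.\<close>

lemma cur_error_bound:
  assumes M: "M \<in> carrier_mat m n" and L: "L \<in> carrier_mat m r" and N: "N \<in> carrier_mat r n"
    and S: "S \<in> carrier_mat k m" "spectral_norm S \<le> 1"
    and T: "T \<in> carrier_mat n l" "spectral_norm T \<le> 1"
    and A: "A \<in> carrier_mat k l"
    and U: "rank_pseudo_inverse r A U" and UG: "U * (S * M * T) = U * A"
    and best: "spectral_norm (S * M * T - A) \<le> spectral_norm (S * M * T - (S * L) * (N * T))"
    and near: "spectral_norm (M - L * N) \<le> \<epsilon>" and \<theta>: "\<epsilon> * spectral_norm U < 1"
    and v: "spectral_norm U * spectral_norm (M * T) \<le> v" "spectral_norm U * spectral_norm (S * M) \<le> v"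
  shows "spectral_norm (M - M * T * U * (S * M))
    \<le> (v + 1) * (2 * wedin_const r k l / (1 - \<epsilon> * spectral_norm U) * (v + 1) + 2) * \<epsilon>"
proof -
  have pU: "is_pseudo_inverse A U" using U by (simp add: rank_pseudo_inverse_def)
  have [simp]: "dim_row M = m" "dim_col M = n" "dim_row L = m" "dim_col L = r" "dim_row N = r"
    "dim_col N = n" "dim_row S = k" "dim_col S = m" "dim_row T = n" "dim_col T = l"
    "dim_row A = k" "dim_col A = l" "dim_row U = l" "dim_col U = k"
    using M L N S T A pU by (auto simp: is_pseudo_inverse_def)
  define G where "G = S * M * T"
  define B where "B = (S * L) * (N * T)"
  define M' where "M' = L * N"
  define C R C' R' where "C = M * T" and "R = S * M" and "C' = M' * T" and "R' = S * M'"
  have [simp]: "dim_row G = k" "dim_col G = l" "dim_row B = k" "dim_col B = l" "dim_row M' = m"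
    "dim_col M' = n" "dim_row C = m" "dim_col C = l" "dim_row R = k" "dim_col R = n"
    "dim_row C' = m" "dim_col C' = l" "dim_row R' = k" "dim_col R' = n"
    by (simp_all add: G_def B_def M'_def C_def R_def C'_def R'_def)
  define u where "u = spectral_norm U"
  define \<theta> where "\<theta> = \<epsilon> * u"
  have \<theta>1: "\<theta> < 1" using \<open>\<epsilon> * spectral_norm U < 1\<close> by (simp add: \<theta>_def u_def)
  have u0: "0 \<le> u" by (simp add: u_def)
  have MM': "spectral_norm (M - M') \<le> \<epsilon>" using near by (simp add: M'_def)
  then have \<epsilon>0: "0 \<le> \<epsilon>" using spectral_norm_nonneg order_trans by blast
  have v0: "0 \<le> v" using v(1) by (meson mult_nonneg_nonneg order_trans spectral_norm_nonneg)
  have CC': "spectral_norm (C' - C) \<le> \<epsilon>"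
  proof -
    have "C' - C = (M' - M) * T" by (simp add: C_def C'_def diff_mult_dim)
    also have "spectral_norm \<dots> \<le> \<epsilon> * 1"
      using MM' T(2) by (intro spectral_norm_mult_le) (auto simp: spectral_norm_minus_commute[of M' M])
    finally show ?thesis by simp
  qed
  have RR': "spectral_norm (R' - R) \<le> \<epsilon>"
  proof -
    have "R' - R = S * (M' - M)" by (simp add: R_def R'_def mult_diff_dim)
    also have "spectral_norm \<dots> \<le> 1 * \<epsilon>"
      using MM' S(2) by (intro spectral_norm_mult_le) (auto simp: spectral_norm_minus_commute[of M' M])
    finally show ?thesis by simp
  qed
  have GB: "spectral_norm (G - B) \<le> \<epsilon>"
  proof -
    have "G - B = S * ((M - M') * T)"
      by (simp add: G_def B_def M'_def diff_mult_dim mult_diff_dim mult_assoc_dim)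
    also have "spectral_norm \<dots> \<le> 1 * (\<epsilon> * 1)"
      using MM' S(2) T(2) by (intro spectral_norm_mult_le) auto
    finally show ?thesis by simp
  qed
  have AB: "spectral_norm (A - B) \<le> 2 * \<epsilon>"
  proof -
    have "A - B = (A - G) + (G - B)" by (intro eq_matI) auto
    then have "spectral_norm (A - B) \<le> spectral_norm (A - G) + spectral_norm (G - B)"
      using spectral_norm_add[of "A - G" "G - B"] by simp
    also have "spectral_norm (A - G) = spectral_norm (G - A)" by (rule spectral_norm_minus_commute) auto
    finally show ?thesis using best GB by (simp add: G_def B_def)
  qed
  obtain W where W: "is_pseudo_inverse B W" "N * T * W * (S * L) = 1\<^sub>m r"
    and wu: "(1 - \<theta>) * spectral_norm W \<le> u"
    unfolding B_def \<theta>_def u_def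
  proof (rule nearby_pseudo_inverse[OF _ A U])
    show "G \<in> carrier_mat k l" "S * L \<in> carrier_mat k r" "N * T \<in> carrier_mat r l"
      by (auto intro!: carrier_matI)
    show "U * G = U * A" using UG by (simp add: G_def)
    show "spectral_norm (G - (S * L) * (N * T)) \<le> \<epsilon>" using GB by (simp add: B_def)
    show "\<epsilon> * spectral_norm U < 1" by fact
  qed
  have [simp]: "dim_row W = l" "dim_col W = k" using W(1) by (auto simp: is_pseudo_inverse_def)
  have "S * L \<in> carrier_mat k r" "N * T \<in> carrier_mat r l" by (auto intro!: carrier_matI)
  then have "rank_pseudo_inverse r B W"
    unfolding rank_pseudo_inverse_def using W B_def \<open>dim_row B = k\<close> \<open>dim_col B = l\<close> by blast
  then have "spectral_norm (W - U) \<le> wedin_const r k l * (spectral_norm (A - B) * u * spectral_norm W)"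
    unfolding u_def by (intro Wedin A U carrier_matI) auto
  also have "\<dots> \<le> wedin_const r k l * ((2 * \<epsilon>) * u * (u / (1 - \<theta>)))"
  proof (intro mult_left_mono mult_mono)
    show "spectral_norm W \<le> u / (1 - \<theta>)" using wu \<theta>1 by (simp add: field_simps)
  qed (use AB u0 \<epsilon>0 in \<open>auto simp: wedin_const_def\<close>)
  finally have WU: "spectral_norm (W - U) \<le> 2 * wedin_const r k l / (1 - \<theta>) * \<epsilon> * u\<^sup>2"
    by (simp add: power2_eq_square mult_ac)

  have "C' * W * R' = L * (N * T * W * (S * L)) * N"
    by (simp add: C'_def R'_def M'_def mult_assoc_dim)
  then have CWR: "C' * W * R' = M'" unfolding W(2) by (simp add: M'_def)
  have "M - C * U * R = (M - M') + (((C' - C) * U * R + C' * U * (R' - R)) + C' * (W - U) * R')"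
    unfolding CWR[symmetric]
    by (simp add: diff_mult_dim mult_diff_dim mult_assoc_dim) (intro eq_matI; simp)
  also have "spectral_norm \<dots> \<le> spectral_norm (M - M') +
      (spectral_norm ((C' - C) * U * R) + spectral_norm (C' * U * (R' - R)) + spectral_norm (C' * (W - U) * R'))"
    using spectral_norm_add[of "M - M'" "((C' - C) * U * R + C' * U * (R' - R)) + C' * (W - U) * R'"]
      spectral_norm_add[of "(C' - C) * U * R + C' * U * (R' - R)" "C' * (W - U) * R'"]
      spectral_norm_add[of "(C' - C) * U * R" "C' * U * (R' - R)"] by simp
  finally have total: "spectral_norm (M - C * U * R) \<le> spectral_norm (M - M') +
      (spectral_norm ((C' - C) * U * R) + spectral_norm (C' * U * (R' - R)) + spectral_norm (C' * (W - U) * R'))" .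
  have C'u: "spectral_norm C' * u \<le> v + 1" and R'u: "spectral_norm R' * u \<le> v + 1"
  proof -
    have "C' = C + (C' - C)" "R' = R + (R' - R)" by (intro eq_matI; simp)+
    then have "spectral_norm C' \<le> spectral_norm C + \<epsilon>" "spectral_norm R' \<le> spectral_norm R + \<epsilon>"
      using spectral_norm_add[of C "C' - C"] spectral_norm_add[of R "R' - R"] CC' RR' by auto
    then have "spectral_norm C' * u \<le> (spectral_norm C + \<epsilon>) * u"
      "spectral_norm R' * u \<le> (spectral_norm R + \<epsilon>) * u" using u0 by (auto intro: mult_right_mono)
    then show "spectral_norm C' * u \<le> v + 1" "spectral_norm R' * u \<le> v + 1"
      using v \<theta>1 by (auto simp: C_def R_def u_def \<theta>_def algebra_simps)
  qed
  have "spectral_norm ((C' - C) * U * R) \<le> \<epsilon> * (u * spectral_norm R)"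
    using CC' by (subst mult_assoc_dim) (auto intro!: spectral_norm_mult_le simp: u_def)
  also have "\<dots> \<le> \<epsilon> * v" using v \<epsilon>0 by (intro mult_left_mono) (auto simp: u_def R_def)
  finally have t1: "spectral_norm ((C' - C) * U * R) \<le> v * \<epsilon>" by (simp add: mult.commute)
  have "spectral_norm (C' * U * (R' - R)) \<le> (spectral_norm C' * u) * \<epsilon>"
    using RR' by (intro spectral_norm_mult_le) (auto simp: u_def)
  also have "\<dots> \<le> (v + 1) * \<epsilon>" using C'u \<epsilon>0 by (rule mult_right_mono)
  finally have t2: "spectral_norm (C' * U * (R' - R)) \<le> (v + 1) * \<epsilon>" .
  have "spectral_norm (C' * (W - U) * R')
      \<le> (spectral_norm C' * (2 * wedin_const r k l / (1 - \<theta>) * \<epsilon> * u\<^sup>2)) * spectral_norm R'"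
    using WU by (intro spectral_norm_mult_le) auto
  also have "\<dots> = (2 * wedin_const r k l / (1 - \<theta>) * \<epsilon>) * ((spectral_norm C' * u) * (spectral_norm R' * u))"
    by (simp add: power2_eq_square mult_ac)
  also have "\<dots> \<le> (2 * wedin_const r k l / (1 - \<theta>) * \<epsilon>) * ((v + 1) * (v + 1))"
    using C'u R'u \<epsilon>0 \<theta>1 v0 u0 by (intro mult_left_mono mult_mono) (auto simp: wedin_const_def)
  finally have t3: "spectral_norm (C' * (W - U) * R')
      \<le> (2 * wedin_const r k l / (1 - \<theta>) * \<epsilon>) * ((v + 1) * (v + 1))" .
  have "spectral_norm (M - C * U * R)
      \<le> \<epsilon> + (v * \<epsilon> + (v + 1) * \<epsilon> + (2 * wedin_const r k l / (1 - \<theta>) * \<epsilon>) * ((v + 1) * (v + 1)))"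
    using total MM' t1 t2 t3 by linarith
  also have "\<dots> = (v + 1) * (2 * wedin_const r k l / (1 - \<theta>) * (v + 1) + 2) * \<epsilon>"
    by (simp add: algebra_simps)
  finally show ?thesis by (simp add: C_def R_def \<theta>_def u_def)
qed

theorem theorem4p1:
  fixes M M' G Gr C R U :: "real mat"
    and I J :: "nat set"
    and m n k l r :: nat
    and \<epsilon> v \<zeta> \<theta> :: real
  assumes "M \<in> carrier_mat m n"
    and "I \<subseteq> {..<m}" and "card I = k"
    and "J \<subseteq> {..<n}" and "card J = l"
    and "G = submatrix M I J"
    and "0 < r" and "r \<le> min k l"
    and "0 < \<epsilon>" and "\<epsilon> \<le> singular_value G r"
    and "M' \<in> carrier_mat m n" and "vec_space.rank m M' = r"
    and "singular_value M (r + 1) \<le> spectral_norm (M - M')"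
    and "spectral_norm (M - M') \<le> \<epsilon>"
    and "C = submatrix M UNIV J"
    and "R = submatrix M I UNIV"
    and "is_truncation r G Gr" and "U = pseudo_inverse Gr"
    and "v = spectral_norm U * max (spectral_norm C) (spectral_norm R)"
    and "\<zeta> = (if r = min k l then sqrt 2 else (1 + sqrt 5) / 2)"
    and "\<theta> = \<epsilon> * spectral_norm U" and "\<theta> < 1"
  shows "spectral_norm (M - C * U * R)
           \<le> (v + 1) * (2 * \<zeta> / (1 - \<theta>) * (v + 1) + 2) * \<epsilon>
         \<and> 2 * \<zeta> \<le> 1 + sqrt 5"
proof
  define S where "S = row_selector m I"
  define T where "T = transpose_mat (row_selector n J)"
  have S: "S \<in> carrier_mat k m" "spectral_norm S \<le> 1"
    using row_selector_carrier[OF assms(2)] spectral_norm_row_selector[OF assms(2)] assms(3)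
    by (auto simp: S_def)
  have T: "T \<in> carrier_mat n l" "spectral_norm T \<le> 1"
    using row_selector_carrier[OF assms(4)] spectral_norm_row_selector[OF assms(4)] assms(5)
    by (auto simp: T_def spectral_norm_transpose)
  have [simp]: "dim_row M = m" "dim_col M = n" "dim_row S = k" "dim_col S = m" "dim_row T = n" "dim_col T = l"
    using assms(1) S T by auto
  have C: "C = M * T" using submatrix_cols[OF assms(4), of M] assms(15) by (simp add: T_def)
  have R: "R = S * M" using submatrix_rows[OF assms(2), of M] assms(16) by (simp add: S_def)
  have "G = submatrix (submatrix M UNIV J) I UNIV" using submatrix_split assms(6) by metis
  also have "\<dots> = S * (M * T)"
    using submatrix_rows[OF assms(2), of C] by (simp add: assms(15)[symmetric] C S_def[symmetric])
  finally have G: "G = S * M * T" by (simp add: mult_assoc_dim)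
  then have Gc: "G \<in> carrier_mat k l" by (intro carrier_matI) auto
  obtain L N where LN: "L \<in> carrier_mat m r" "N \<in> carrier_mat r n" "M' = L * N"
    using rank_factorization[OF assms(11,12)] by blast
  obtain P s Q where svd: "is_svd G P s Q"
    and Gr: "Gr = P * rect_diag k l (\<lambda>i. if i < r then s i else 0) * transpose_mat Q"
    using assms(17) Gc unfolding is_truncation_def by auto
  have "singular_value G (Suc (r - 1)) = s (r - 1)"
    using assms(7,8) by (intro singular_value_svd[OF svd Gc]) auto
  then have "0 < s (r - 1)" using assms(7,9,10) by simp
  from truncation_pseudo_inverse[OF svd Gc assms(7,8) this Gr] obtain U' where
    U': "rank_pseudo_inverse r Gr U'" "U' * G = U' * Gr" .
  then have U: "U = U'" using pseudo_inverse_eq assms(18) by (auto simp: rank_pseudo_inverse_def)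
  have "Gr \<in> carrier_mat k l"
    unfolding Gr using svd_dims[OF svd Gc] by (intro carrier_matI) auto
  moreover have "spectral_norm (G - Gr) \<le> spectral_norm (G - (S * L) * (N * T))"
    using LN S T by (intro truncation_error_le[OF svd Gc assms(8) Gr]) auto
  moreover have "spectral_norm U * spectral_norm C \<le> v" "spectral_norm U * spectral_norm R \<le> v"
    unfolding assms(19) by (auto intro: mult_left_mono)
  ultimately have "spectral_norm (M - M * T * U * (S * M))
      \<le> (v + 1) * (2 * wedin_const r k l / (1 - \<epsilon> * spectral_norm U) * (v + 1) + 2) * \<epsilon>"
    using U' assms(14,21,22) unfolding U G C R LN(3)
    by (intro cur_error_bound[OF assms(1) LN(1,2) S T]) auto
  then show "spectral_norm (M - C * U * R) \<le> (v + 1) * (2 * \<zeta> / (1 - \<theta>) * (v + 1) + 2) * \<epsilon>"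
    using assms(20,21) by (simp add: C R wedin_const_def)
  have "sqrt 2 \<le> sqrt (9 / 4 :: real)" by (intro real_sqrt_le_mono) simp
  also have "\<dots> = 3 / 2" by (simp add: real_sqrt_divide)
  also have "2 \<le> sqrt (5 :: real)" by (rule real_le_rsqrt) simp
  then have "3 / 2 \<le> (1 + sqrt 5) / (2 :: real)" by simp
  finally show "2 * \<zeta> \<le> 1 + sqrt 5" using assms(20) by (simp add: field_simps split: if_splits)
qed

end
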